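(* Let $D$ be a Dedekind domain with infinitely many maximal ideals, all of them of finite index, and let $K$ be its quotient field. Let $n\ge 1$ and let $1\le m_1\le m_2\le\cdots\le m_n$ be natural numbers. Then there exists a polynomial $H\in \operatorname{Int}(D)$ which has exactly $n$ essentially different factorizations into irreducible elements of $\operatorname{Int}(D)$, the lengths of these factorizations being $m_1+1,\ldots,m_n+1$.
   Context: $\operatorname{Int}(D)=\{f\in K[x]\mid f(D)\subseteq D\}$ is the ring of integer-valued polynomials on $D$. A maximal ideal $P$ has finite index if $D/P$ is finite. An element $r$ of a commutative ring $R$ is irreducible if it is a non-zero non-unit that is not a product of two non-units. A factorization of $r$ is an expression $r=a_1\cdots a_k$ with $k\ge1$ and all $a_i$ irreducible; $k$ is its length. Two factorizations $r=a_1\cdots a_k=b_1\cdots b_l$ are essentially the same if $k=l$ and, after reindexing, $a_j=u_jb_j$ with $u_j$ a unit of $R$ for all $j$; otherwise they are essentially different. *)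

theory Defs
  imports "HOL-Computational_Algebra.Fraction_Field" "HOL-Computational_Algebra.Polynomial"
begin

definition is_ideal :: "'a::comm_ring_1 set \<Rightarrow> bool" where
  "is_ideal I \<longleftrightarrow> 0 \<in> I \<and> (\<forall>a\<in>I. \<forall>b\<in>I. a + b \<in> I) \<and> (\<forall>a\<in>I. \<forall>r. r * a \<in> I)"

definition prime_ideal :: "'a::comm_ring_1 set \<Rightarrow> bool" where
  "prime_ideal P \<longleftrightarrow> is_ideal P \<and> P \<noteq> UNIV \<and> (\<forall>a b. a * b \<in> P \<longrightarrow> a \<in> P \<or> b \<in> P)"

definition maximal_ideal :: "'a::comm_ring_1 set \<Rightarrow> bool" where
  "maximal_ideal M \<longleftrightarrow> is_ideal M \<and> M \<noteq> UNIV \<and>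
     (\<forall>J. is_ideal J \<and> M \<subseteq> J \<longrightarrow> J = M \<or> J = UNIV)"

definition gen_ideal :: "'a::comm_ring_1 set \<Rightarrow> 'a set" where
  "gen_ideal S = {x. \<exists>r. x = (\<Sum>s\<in>S. r s * s)}"

definition noetherian_ring :: "'a::comm_ring_1 itself \<Rightarrow> bool" where
  "noetherian_ring _ \<longleftrightarrow> (\<forall>I::'a set. is_ideal I \<longrightarrow> (\<exists>S. finite S \<and> I = gen_ideal S))"

definition emb :: "'a::idom \<Rightarrow> 'a fract" where
  "emb a = Fraction_Field.Fract a 1"

definition integrally_closed :: "'a::idom itself \<Rightarrow> bool" where
  "integrally_closed _ \<longleftrightarrow>
     (\<forall>x::'a fract. (\<exists>p::'a poly. lead_coeff p = 1 \<and> poly (map_poly emb p) x = 0)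
        \<longrightarrow> x \<in> range emb)"

definition dedekind_domain :: "'a::idom itself \<Rightarrow> bool" where
  "dedekind_domain T \<longleftrightarrow> noetherian_ring T \<and> integrally_closed T \<and>
     (\<forall>P::'a set. prime_ideal P \<and> P \<noteq> {0} \<longrightarrow> maximal_ideal P)"

definition residue_classes :: "'a::comm_ring_1 set \<Rightarrow> 'a set set" where
  "residue_classes P = range (\<lambda>a. {a + p | p. p \<in> P})"

definition IntD :: "'a::idom fract poly set" where
  "IntD = {f. \<forall>a. poly f (emb a) \<in> range emb}"

text \<open>Units, irreducibles, factorizations in a subring R (given as a subset closed under the operations).\<close>
definition unit_in :: "'b::comm_ring_1 set \<Rightarrow> 'b \<Rightarrow> bool" where
  "unit_in R u \<longleftrightarrow> u \<in> R \<and> (\<exists>v\<in>R. u * v = 1)"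

definition irreducible_in :: "'b::comm_ring_1 set \<Rightarrow> 'b \<Rightarrow> bool" where
  "irreducible_in R r \<longleftrightarrow> r \<in> R \<and> r \<noteq> 0 \<and> \<not> unit_in R r \<and>
     (\<forall>a\<in>R. \<forall>b\<in>R. r = a * b \<longrightarrow> unit_in R a \<or> unit_in R b)"

definition factorization_in :: "'b::comm_ring_1 set \<Rightarrow> 'b \<Rightarrow> 'b list \<Rightarrow> bool" where
  "factorization_in R r fs \<longleftrightarrow> length fs \<ge> 1 \<and> (\<forall>a\<in>set fs. irreducible_in R a) \<and> prod_list fs = r"

definition ess_same_in :: "'b::comm_ring_1 set \<Rightarrow> 'b list \<Rightarrow> 'b list \<Rightarrow> bool" where
  "ess_same_in R fs gs \<longleftrightarrow> length fs = length gs \<and>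
     (\<exists>\<sigma>. bij_betw \<sigma> {..<length fs} {..<length fs} \<and>
        (\<forall>j<length fs. \<exists>u. unit_in R u \<and> fs ! j = u * gs ! (\<sigma> j)))"

end

theory Submission
  imports Defs "HOL-Computational_Algebra.Polynomial_Factorial" "HOL-Combinatorics.List_Permutation"
begin

text \<open>
  Let \<open>U\<close> be the disjoint union of blocks \<open>S 1, \<dots>, S n\<close> with \<open>card (S k) = m k\<close>. Choose a maximal
  ideal \<open>P\<close> with many residue classes and an element \<open>c\<close> generating \<open>P\<close> locally at \<open>P\<close>. Assign to every pair
  \<open>(t, u)\<close> of indices from different blocks its own residue class modulo \<open>P\<close>, and let \<open>f t\<close> vanish
  modulo \<open>P\<close> on the classes of the pairs containing \<open>t\<close>, while \<open>s\<close> vanishes on all the classes not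
  assigned to a pair. Then \<open>s * (\<Prod>t\<in>U - W. f t)\<close> has all values in \<open>P\<close> iff \<open>W\<close> does not meet two
  blocks. At the other maximal ideals containing \<open>c\<close> the values of \<open>s\<close> are divisible by \<open>c\<close>, exactly
  so somewhere, and no other maximal ideal contains all the values of \<open>s * (\<Prod>t\<in>U. f t)\<close>. All these
  conditions are congruences, so \<open>s\<close> and the \<open>f t\<close> can be taken monic, irreducible over the quotient
  field (by Eisenstein's criterion at further maximal ideals) and distinct. The factorizations of
  \<open>H = s * (\<Prod>t\<in>U. f t) / c\<close> are then, one for each \<open>k\<close>, the product of \<open>s * (\<Prod>t\<in>U - S k. f t) / c\<close>
  and the \<open>m k\<close> polynomials \<open>f t\<close> with \<open>t \<in> S k\<close>.
\<close>

section \<open>Ideals and local divisibility\<close>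

text \<open>The ring need not be principal, so an element \<open>c\<close> of order one at
  \<open>P\<close> may lie in further maximal ideals; this obstacle is why divisibility is handled
  locally throughout. At those ideals \<open>s\<close> alone supplies the factor \<open>c\<close>,
  so they put no condition on \<open>W\<close>. At \<open>P\<close>, deleting the factors of
  \<open>W\<close> uncovers exactly the classes of the pairs contained in \<open>W\<close>, which
  turns a statement about blocks into one about values. The residue classes of 0 and 1 are kept
  free. Polynomials of too small degree are multiplied by powers of the variable, whose values are
  harmless away from the class of 0. In the class of 1 the order of \<open>s\<close> is exactly that
  of \<open>c\<close> while no \<open>f t\<close> vanishes; this exactness is what keeps a nonunit
  constant from being moved into a product of the \<open>f t\<close>. The common degree lets Chinese
  remaindering leave the leading coefficient equal to 1.\<close>

lemma ideal_zero: "is_ideal I \<Longrightarrow> 0 \<in> I"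
  by (simp add: is_ideal_def)

lemma ideal_add: "is_ideal I \<Longrightarrow> a \<in> I \<Longrightarrow> b \<in> I \<Longrightarrow> a + b \<in> I"
  by (simp add: is_ideal_def)

lemma ideal_mult: "is_ideal I \<Longrightarrow> a \<in> I \<Longrightarrow> r * a \<in> I"
  by (simp add: is_ideal_def)

lemma ideal_mult_right: "is_ideal I \<Longrightarrow> a \<in> I \<Longrightarrow> a * r \<in> I"
  using ideal_mult[of I a r] by (simp add: mult.commute)

lemma ideal_uminus: "is_ideal I \<Longrightarrow> a \<in> I \<Longrightarrow> - a \<in> I"
  using ideal_mult[of I a "- 1"] by simp

lemma ideal_diff: "is_ideal I \<Longrightarrow> a \<in> I \<Longrightarrow> b \<in> I \<Longrightarrow> a - b \<in> I"
  using ideal_add[of I a "- b"] ideal_uminus[of I b] by simp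

lemma ideal_diff_commute: "is_ideal I \<Longrightarrow> a - b \<in> I \<Longrightarrow> b - a \<in> I"
  using ideal_uminus[of I "a - b"] by simp

lemma ideal_diff_trans: "is_ideal I \<Longrightarrow> a - b \<in> I \<Longrightarrow> b - d \<in> I \<Longrightarrow> a - d \<in> I"
  using ideal_add[of I "a - b" "b - d"] by simp

lemma ideal_mem_cong: "is_ideal I \<Longrightarrow> a - b \<in> I \<Longrightarrow> a \<in> I \<longleftrightarrow> b \<in> I"
  using ideal_add[of I "a - b" b] ideal_diff[of I a "a - b"] by auto

lemma ideal_dvd: "is_ideal I \<Longrightarrow> a \<in> I \<Longrightarrow> a dvd b \<Longrightarrow> b \<in> I"
  by (auto simp: dvd_def ideal_mult_right)

lemma ideal_sum: "is_ideal I \<Longrightarrow> (\<And>x. x \<in> A \<Longrightarrow> f x \<in> I) \<Longrightarrow> sum f A \<in> I"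
  by (induction A rule: infinite_finite_induct) (auto intro: ideal_zero ideal_add)

lemma ideal_prod: "is_ideal I \<Longrightarrow> finite A \<Longrightarrow> x \<in> A \<Longrightarrow> f x \<in> I \<Longrightarrow> prod f A \<in> I"
  by (rule ideal_dvd) (auto intro: dvd_prodI)

lemma ideal_eq_UNIV: "is_ideal I \<Longrightarrow> 1 \<in> I \<Longrightarrow> I = UNIV"
  using ideal_mult[of I 1] by auto

lemma is_ideal_adjoin:
  fixes I :: "'a::comm_ring_1 set"
  assumes "is_ideal I"
  shows "is_ideal {i + r * x | i r. i \<in> I}"
  unfolding is_ideal_def
proof (intro conjI ballI allI)
  have "0 = 0 + 0 * x" by simp
  then show "0 \<in> {i + r * x | i r. i \<in> I}" using ideal_zero[OF assms] by blast
  fix a assume "a \<in> {i + r * x | i r. i \<in> I}"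
  then obtain i r where a: "a = i + r * x" "i \<in> I" by blast
  have "s * a = s * i + (s * r) * x" for s using a(1) by (simp add: algebra_simps)
  then show "s * a \<in> {i + r * x | i r. i \<in> I}" for s using ideal_mult[OF assms a(2)] by blast
  fix b assume "b \<in> {i + r * x | i r. i \<in> I}"
  then obtain j s where b: "b = j + s * x" "j \<in> I" by blast
  have "a + b = (i + j) + (r + s) * x" using a(1) b(1) by (simp add: algebra_simps)
  then show "a + b \<in> {i + r * x | i r. i \<in> I}" using ideal_add[OF assms a(2) b(2)] by blast
qed

lemma adjoin_superset: "(I :: 'a::comm_ring_1 set) \<subseteq> {i + r * x | i r. i \<in> I}"
proof
  fix y assume "y \<in> I"
  moreover have "y = y + 0 * x" by simp
  ultimately show "y \<in> {i + r * x | i r. i \<in> I}" by blast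
qed

lemma adjoin_mem: "is_ideal I \<Longrightarrow> x \<in> {i + r * x | i r. i \<in> I}"
proof -
  assume "is_ideal I"
  then have "x = 0 + 1 * x" "0 \<in> I" using ideal_zero by auto
  then show ?thesis by blast
qed

section \<open>Maximal ideals and avoidance of products\<close>

lemma maximal_ideal_ideal: "maximal_ideal Q \<Longrightarrow> is_ideal Q"
  by (simp add: maximal_ideal_def)

lemma maximal_one_notin: "maximal_ideal Q \<Longrightarrow> 1 \<notin> Q"
  using ideal_eq_UNIV by (auto simp: maximal_ideal_def)

lemma maximal_subset_eq: "maximal_ideal M \<Longrightarrow> maximal_ideal Q \<Longrightarrow> M \<subseteq> Q \<Longrightarrow> M = Q"
  by (auto simp: maximal_ideal_def)

lemma maximal_imp_prime:
  assumes "maximal_ideal Q"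
  shows "prime_ideal Q"
  unfolding prime_ideal_def
proof (intro conjI allI impI)
  have Q: "is_ideal Q" using assms by (rule maximal_ideal_ideal)
  show "is_ideal Q" "Q \<noteq> UNIV" using assms by (auto simp: maximal_ideal_def)
  fix a b assume ab: "a * b \<in> Q"
  show "a \<in> Q \<or> b \<in> Q"
  proof (rule disjCI)
    assume "b \<notin> Q"
    let ?J = "{i + r * b | i r. i \<in> Q}"
    have "?J = UNIV"
      using assms is_ideal_adjoin[OF Q, of b] adjoin_superset[of Q b] adjoin_mem[OF Q, of b] \<open>b \<notin> Q\<close>
      unfolding maximal_ideal_def by blast
    then obtain i r where ir: "1 = i + r * b" "i \<in> Q" by blast
    have "a = (i + r * b) * a" using ir(1) by simp
    also have "\<dots> = i * a + r * (a * b)" by (simp add: algebra_simps)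
    finally show "a \<in> Q"
      using ir(2) ab Q by (metis ideal_add ideal_mult ideal_mult_right)
  qed
qed

lemma prime_ideal_mult_iff: "prime_ideal Q \<Longrightarrow> a * b \<in> Q \<longleftrightarrow> a \<in> Q \<or> b \<in> Q"
  unfolding prime_ideal_def using ideal_mult ideal_mult_right by blast

lemma maximal_mult_iff: "maximal_ideal Q \<Longrightarrow> a * b \<in> Q \<longleftrightarrow> a \<in> Q \<or> b \<in> Q"
  using prime_ideal_mult_iff maximal_imp_prime by blast

lemma maximal_power: "maximal_ideal Q \<Longrightarrow> a \<notin> Q \<Longrightarrow> a ^ n \<notin> Q"
  by (induction n) (auto simp: maximal_mult_iff maximal_one_notin)

lemma maximal_prod:
  "maximal_ideal Q \<Longrightarrow> (\<And>x. x \<in> A \<Longrightarrow> f x \<notin> Q) \<Longrightarrow> prod f A \<notin> Q"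
  by (induction A rule: infinite_finite_induct) (auto simp: maximal_mult_iff maximal_one_notin)

text \<open>The union of an ascending chain of ideals is an ideal, and its finitely many generators
  already lie in one member, after which the chain cannot grow. Larger ideals count as smaller in
  the relation, so induction may assume the claim for all larger ideals.\<close>

lemma wf_ideals:
  assumes "noetherian_ring (T :: 'a::comm_ring_1 itself)"
  shows "wf {(J, I :: 'a set). is_ideal I \<and> is_ideal J \<and> I \<subset> J}"
  unfolding wf_iff_no_infinite_down_chain
proof
  assume "\<exists>f. \<forall>i. (f (Suc i), f i) \<in> {(J, I :: 'a set). is_ideal I \<and> is_ideal J \<and> I \<subset> J}"
  then obtain f :: "nat \<Rightarrow> 'a set"
    where "\<forall>i. (f (Suc i), f i) \<in> {(J, I). is_ideal I \<and> is_ideal J \<and> I \<subset> J}" by blast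
  then have f: "is_ideal (f i)" "f i \<subset> f (Suc i)" for i by simp_all
  have mono: "f i \<subseteq> f j" if "i \<le> j" for i j
    by (rule lift_Suc_mono_le[OF _ that]) (rule psubset_imp_subset[OF f(2)])
  have "is_ideal (\<Union>i. f i)"
    unfolding is_ideal_def
  proof (intro conjI ballI allI)
    show "0 \<in> (\<Union>i. f i)" using ideal_zero[OF f(1)] by blast
    fix a assume "a \<in> (\<Union>i. f i)"
    then obtain i where i: "a \<in> f i" by blast
    then show "r * a \<in> (\<Union>i. f i)" for r using ideal_mult[OF f(1)] by blast
    fix b assume "b \<in> (\<Union>i. f i)"
    then obtain j where "b \<in> f j" by blast
    then have "a \<in> f (max i j)" "b \<in> f (max i j)"
      using i mono[of i "max i j"] mono[of j "max i j"] by auto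
    then show "a + b \<in> (\<Union>i. f i)" using ideal_add[OF f(1)] by blast
  qed
  then obtain S where S: "finite S" "(\<Union>i. f i) = gen_ideal S"
    using assms unfolding noetherian_ring_def by metis
  have "S \<subseteq> gen_ideal S"
  proof
    fix s assume "s \<in> S"
    have "(\<Sum>x\<in>S. (if x = s then 1 else 0) * x) = (\<Sum>x\<in>S. if x = s then x else 0)"
      by (rule sum.cong) auto
    then have "s = (\<Sum>x\<in>S. (if x = s then 1 else 0) * x)" using S(1) \<open>s \<in> S\<close> by simp
    then show "s \<in> gen_ideal S"
      unfolding gen_ideal_def by (intro CollectI exI[of _ "\<lambda>x. if x = s then 1 else 0"])
  qed
  then have "\<forall>s\<in>S. \<exists>i. s \<in> f i" using S(2) by blast
  then obtain k where k: "\<forall>s\<in>S. s \<in> f (k s)" by metis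
  have "S \<subseteq> f (Max (k ` S))"
  proof
    fix s assume "s \<in> S"
    then have "k s \<le> Max (k ` S)" "s \<in> f (k s)" using k S(1) by auto
    then show "s \<in> f (Max (k ` S))" using mono by blast
  qed
  then have "gen_ideal S \<subseteq> f (Max (k ` S))"
  proof (intro subsetI)
    fix x assume "x \<in> gen_ideal S"
    then obtain r where x: "x = (\<Sum>s\<in>S. r s * s)" unfolding gen_ideal_def by blast
    show "x \<in> f (Max (k ` S))"
      unfolding x using \<open>S \<subseteq> f (Max (k ` S))\<close> f(1) by (intro ideal_sum ideal_mult) auto
  qed
  moreover have "f (Suc (Max (k ` S))) \<subseteq> gen_ideal S"
    unfolding S(2)[symmetric] by (rule UN_upper) simp
  ultimately show False using f(2)[of "Max (k ` S)"] by auto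
qed

lemma noetherian_induct [consumes 2, case_names step]:
  assumes "noetherian_ring (T :: 'a::comm_ring_1 itself)" and "is_ideal (I :: 'a set)"
    and "\<And>I. is_ideal I \<Longrightarrow> (\<And>J. is_ideal J \<Longrightarrow> I \<subset> J \<Longrightarrow> P J) \<Longrightarrow> P I"
  shows "P I"
  using wf_ideals[OF assms(1)] assms(2)
proof (induction I rule: wf_induct_rule)
  case (less I)
  show ?case
  proof (rule assms(3)[OF less.prems])
    fix J assume "is_ideal J" "I \<subset> J"
    then show "P J" using less.IH[of J] less.prems by simp
  qed
qed

text \<open>Noetherian induction takes the place of Zorn's lemma.\<close>

lemma exists_maximal_ideal:
  assumes "noetherian_ring (T :: 'a::comm_ring_1 itself)" "is_ideal (I :: 'a set)" "I \<noteq> UNIV"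
  shows "\<exists>M. maximal_ideal M \<and> I \<subseteq> M"
  using assms
proof (induction I rule: noetherian_induct)
  case (step I)
  show ?case
  proof (cases "maximal_ideal I")
    case False
    then obtain J where "is_ideal J" "I \<subset> J" "J \<noteq> UNIV"
      using step.hyps step.prems unfolding maximal_ideal_def by blast
    then obtain M where "maximal_ideal M" "J \<subseteq> M" using step.IH by blast
    then show ?thesis using \<open>I \<subset> J\<close> by blast
  qed auto
qed

text \<open>For maximal \<open>Q\<close>, \<open>loc Q z\<close> is the contraction to the ring of the ideal generated by \<open>z\<close> in the
  localization at \<open>Q\<close>, and \<open>locassoc Q\<close> is associatedness in this localization.\<close>

definition loc :: "'a::comm_ring_1 set \<Rightarrow> 'a \<Rightarrow> 'a set" where
  "loc Q z = {y. \<exists>s. s \<notin> Q \<and> z dvd s * y}"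

definition locassoc :: "'a::comm_ring_1 set \<Rightarrow> 'a \<Rightarrow> 'a \<Rightarrow> bool" where
  "locassoc Q c d \<longleftrightarrow> (\<exists>s s'. s \<notin> Q \<and> s' \<notin> Q \<and> s * c = s' * d)"

lemma locI: "s \<notin> Q \<Longrightarrow> z dvd s * y \<Longrightarrow> y \<in> loc Q z"
  by (auto simp: loc_def)

lemma loc_self: "maximal_ideal Q \<Longrightarrow> z dvd y \<Longrightarrow> y \<in> loc Q z"
  by (rule locI[of 1]) (auto simp: maximal_one_notin)

lemma is_ideal_loc:
  assumes "maximal_ideal Q"
  shows "is_ideal (loc Q z)"
  unfolding is_ideal_def
proof (intro conjI ballI allI)
  show "0 \<in> loc Q z" using assms by (rule loc_self) simp
  fix a assume "a \<in> loc Q z"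
  then obtain s where s: "s \<notin> Q" "z dvd s * a" by (auto simp: loc_def)
  show "r * a \<in> loc Q z" for r
    using s by (intro locI[of s]) (auto simp: mult.left_commute)
  fix b assume "b \<in> loc Q z"
  then obtain t where t: "t \<notin> Q" "z dvd t * b" by (auto simp: loc_def)
  have "z dvd t * (s * a) + s * (t * b)" using s t by simp
  then have "z dvd (s * t) * (a + b)" by (simp add: algebra_simps)
  then show "a + b \<in> loc Q z" using s t assms
    by (intro locI[of "s * t"]) (auto simp: maximal_mult_iff)
qed

lemma loc_subset: "maximal_ideal Q \<Longrightarrow> z \<in> Q \<Longrightarrow> loc Q z \<subseteq> Q"
  unfolding loc_def using ideal_dvd maximal_ideal_ideal maximal_mult_iff by blast

lemma loc_antimono: "z' dvd z \<Longrightarrow> loc Q z \<subseteq> loc Q z'"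
  unfolding loc_def using dvd_trans by blast

lemma loc_power:
  assumes "maximal_ideal Q" "y \<in> loc Q z"
  shows "y ^ e \<in> loc Q (z ^ e)"
proof -
  obtain s where s: "s \<notin> Q" "z dvd s * y" using assms by (auto simp: loc_def)
  have "z ^ e dvd s ^ e * y ^ e"
    using dvd_power_same[OF s(2), of e] by (simp add: power_mult_distrib)
  then show ?thesis using s assms maximal_power by (intro locI[of "s ^ e"]) auto
qed

lemma locassoc_subset:
  assumes "maximal_ideal Q" "locassoc Q c d"
  shows "loc Q d \<subseteq> loc Q c"
proof
  obtain s s' where s: "s \<notin> Q" "s' \<notin> Q" "s * c = s' * d" using assms by (auto simp: locassoc_def)
  fix y assume "y \<in> loc Q d"
  then obtain r where r: "r \<notin> Q" "d dvd r * y" by (auto simp: loc_def)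
  have "c dvd s' * d" using s(3) by (metis dvd_triv_right)
  also have "s' * d dvd s' * (r * y)" using r(2) by (rule mult_dvd_mono[OF dvd_refl])
  finally have "c dvd (s' * r) * y" by (simp add: mult.assoc)
  then show "y \<in> loc Q c" using s r assms(1) by (intro locI) (auto simp: maximal_mult_iff)
qed

lemma locassoc_mult_unit:
  assumes "maximal_ideal Q" "locassoc Q c d" "w \<notin> Q"
  shows "locassoc Q c (w * d)"
proof -
  obtain s s' where s: "s \<notin> Q" "s' \<notin> Q" "s * c = s' * d" using assms by (auto simp: locassoc_def)
  have "(w * s) * c = s' * (w * d)" using s(3) by (metis mult.assoc mult.left_commute)
  moreover have "w * s \<notin> Q" using s(1) assms by (simp add: maximal_mult_iff)
  ultimately show ?thesis using s(2) unfolding locassoc_def by blast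
qed

lemma locassoc_trans:
  assumes "maximal_ideal Q" "locassoc Q a b" "locassoc Q b d"
  shows "locassoc Q a d"
proof -
  obtain s s' where s: "s \<notin> Q" "s' \<notin> Q" "s * a = s' * b" using assms by (auto simp: locassoc_def)
  obtain r r' where r: "r \<notin> Q" "r' \<notin> Q" "r * b = r' * d" using assms by (auto simp: locassoc_def)
  have "(r * s) * a = s' * (r * b)" using s(3) by (metis mult.assoc mult.left_commute)
  also have "\<dots> = (s' * r') * d" using r(3) by (simp only: mult.assoc)
  finally have "(r * s) * a = (s' * r') * d" .
  moreover have "r * s \<notin> Q" "s' * r' \<notin> Q" using s r assms(1) by (simp_all add: maximal_mult_iff)
  ultimately show ?thesis unfolding locassoc_def by blast
qed

text \<open>Exact divisibility by \<open>c\<close> at \<open>Q\<close> only depends on the residue class in the localization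
  modulo \<open>c\<^sup>2\<close>.\<close>

lemma locassoc_exact:
  fixes c :: "'a::idom"
  assumes Q: "maximal_ideal Q" and c: "c \<in> Q" "c \<noteq> 0" and d: "locassoc Q c d"
    and g: "g - d \<in> loc Q (c\<^sup>2)" and q: "q \<in> Q"
  shows "g \<noteq> c * q"
proof
  assume gq: "g = c * q"
  obtain s s' where s: "s \<notin> Q" "s' \<notin> Q" "s * c = s' * d" using d by (auto simp: locassoc_def)
  obtain r k where r: "r \<notin> Q" "r * (g - d) = c\<^sup>2 * k" using g by (auto simp: loc_def dvd_def)
  have "r * s' * c * q - r * (s' * d) = s' * (r * (g - d))" using gq by (simp add: algebra_simps)
  then have "r * s' * c * q - r * (s * c) = s' * (c\<^sup>2 * k)" using s(3) r(2) by simp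
  then have "c * (r * s) = c * (r * s' * q - c * (s' * k))"
    by (simp add: algebra_simps power2_eq_square)
  then have "r * s = r * s' * q - c * (s' * k)" using c(2) by (simp only: mult_cancel_left) simp
  also have "\<dots> \<in> Q"
    using q c(1) Q by (intro ideal_diff ideal_mult ideal_mult_right) (auto intro: maximal_ideal_ideal)
  finally show False using r s Q by (auto simp: maximal_mult_iff)
qed

text \<open>The multipliers \<open>s\<close> with \<open>z dvd s * y\<close> form an ideal, and each
  local hypothesis exhibits one of them outside the given maximal ideal; an ideal inside no maximal
  ideal contains 1.\<close>

lemma dvd_local:
  assumes "noetherian_ring (T :: 'a::comm_ring_1 itself)"
    and "\<And>Q :: 'a set. maximal_ideal Q \<Longrightarrow> y \<in> loc Q z"
  shows "z dvd y"
proof -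
  let ?J = "{s. z dvd s * y}"
  have J: "is_ideal ?J" by (auto simp: is_ideal_def distrib_right mult.assoc dvd_add)
  have "?J = UNIV"
  proof (rule ccontr)
    assume "?J \<noteq> UNIV"
    then obtain M where "maximal_ideal M" "?J \<subseteq> M"
      using exists_maximal_ideal[OF assms(1) J] by blast
    then show False using assms(2)[of M] by (auto simp: loc_def)
  qed
  then have "1 \<in> ?J" by blast
  then show ?thesis by simp
qed

text \<open>\<open>I\<close> and \<open>x\<close> together lie in no maximal ideal, so
  \<open>x\<close> is a unit modulo \<open>I\<close>, with inverse \<open>r\<close>.\<close>

lemma gen_coprime:
  assumes "noetherian_ring (T :: 'a::comm_ring_1 itself)" "is_ideal (I :: 'a set)"
    and "\<And>M. maximal_ideal M \<Longrightarrow> I \<subseteq> M \<Longrightarrow> x \<notin> M"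
  shows "\<exists>r. 1 - r * x \<in> I"
proof -
  let ?J = "{i + r * x | i r. i \<in> I}"
  have "?J = UNIV"
  proof (rule ccontr)
    assume "?J \<noteq> UNIV"
    then obtain M where "maximal_ideal M" "?J \<subseteq> M"
      using exists_maximal_ideal[OF assms(1) is_ideal_adjoin[OF assms(2)], of x] by blast
    then show False
      using assms(3)[of M] adjoin_superset[of I x] adjoin_mem[OF assms(2), of x] by blast
  qed
  then obtain i r where "1 = i + r * x" "i \<in> I" by blast
  then have "1 - r * x = i" by (simp add: diff_eq_eq)
  then show ?thesis using \<open>i \<in> I\<close> by (intro exI[of _ r]) simp
qed

section \<open>Dedekind domains\<close>

lemma emb_eq_to_fract: "emb = to_fract"
  by (rule ext) (simp add: emb_def to_fract_def)

lemma to_fract_sum: "to_fract (sum f A) = (\<Sum>x\<in>A. to_fract (f x))"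
  by (induction A rule: infinite_finite_induct) auto

lemma fract_poly_sum: "map_poly to_fract (sum f A) = (\<Sum>x\<in>A. map_poly to_fract (f x))"
  by (induction A rule: infinite_finite_induct) auto

lemma to_fract_prod: "to_fract (prod f A) = (\<Prod>x\<in>A. to_fract (f x))"
  by (induction A rule: infinite_finite_induct) auto

text \<open>Fields satisfy \<open>dedekind_domain\<close>; \<open>not_field\<close> excludes them,
  so that every maximal ideal has a nonzero element.\<close>

locale dedekind =
  fixes T :: "'a::idom itself"
  assumes ded: "dedekind_domain T"
    and not_field: "\<not> maximal_ideal {0::'a}"
begin

lemma noeth: "noetherian_ring T"
  using ded by (simp add: dedekind_domain_def)

lemma prime_imp_maximal: "prime_ideal (P :: 'a set) \<Longrightarrow> P \<noteq> {0} \<Longrightarrow> maximal_ideal P"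
  using ded by (simp add: dedekind_domain_def)

lemma maximal_nonzero:
  assumes "maximal_ideal (Q :: 'a set)"
  shows "\<exists>a\<in>Q. a \<noteq> 0"
proof -
  have "0 \<in> Q" "Q \<noteq> {0}"
    using assms not_field ideal_zero[OF maximal_ideal_ideal[OF assms]] by auto
  then show ?thesis by blast
qed

text \<open>If \<open>I\<close> is not prime, the witnesses \<open>x\<close> and \<open>y\<close>
  give two larger ideals, and every maximal ideal above \<open>I\<close> contains one of them
  because it contains \<open>x * y\<close>. If \<open>I\<close> is prime, it is maximal and the only
  ideal to count.\<close>

lemma finite_maximal_over:
  assumes "is_ideal (I :: 'a set)" "I \<noteq> {0}"
  shows "finite {Q. maximal_ideal Q \<and> I \<subseteq> Q}"
  using noeth assms
proof (induction I rule: noetherian_induct)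
  case (step I)
  consider "prime_ideal I" | "I = UNIV" | "\<not> prime_ideal I" "I \<noteq> UNIV" by blast
  then show ?case
  proof cases
    case 1
    then have "maximal_ideal I" using step.prems prime_imp_maximal by blast
    then have "{Q. maximal_ideal Q \<and> I \<subseteq> Q} \<subseteq> {I}" using maximal_subset_eq by blast
    then show ?thesis by (rule finite_subset) simp
  next
    case 2
    then have "{Q. maximal_ideal Q \<and> I \<subseteq> Q} = {}" by (auto simp: maximal_ideal_def)
    then show ?thesis by (simp only: finite.emptyI)
  next
    case 3
    then obtain x y where xy: "x * y \<in> I" "x \<notin> I" "y \<notin> I"
      using step.hyps unfolding prime_ideal_def by blast
    have fin: "finite {Q. maximal_ideal Q \<and> {i + r * w | i r. i \<in> I} \<subseteq> Q}" if "w \<notin> I" for w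
    proof (rule step.IH)
      show "is_ideal {i + r * w | i r. i \<in> I}" using step.hyps by (rule is_ideal_adjoin)
      show "I \<subset> {i + r * w | i r. i \<in> I}"
        using adjoin_superset[of I w] adjoin_mem[OF step.hyps, of w] that by blast
      then show "{i + r * w | i r. i \<in> I} \<noteq> {0}"
        using ideal_zero[OF step.hyps] step.prems by blast
    qed
    have "{Q. maximal_ideal Q \<and> I \<subseteq> Q} \<subseteq>
      {Q. maximal_ideal Q \<and> {i + r * x | i r. i \<in> I} \<subseteq> Q} \<union> {Q. maximal_ideal Q \<and>
        {i + r * y | i r. i \<in> I} \<subseteq> Q}"
    proof
      fix Q assume "Q \<in> {Q. maximal_ideal Q \<and> I \<subseteq> Q}"
      then have Q: "maximal_ideal Q" "I \<subseteq> Q" by auto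
      have sub: "{i + r * w | i r. i \<in> I} \<subseteq> Q" if "w \<in> Q" for w
        using Q that by (auto intro!: ideal_add ideal_mult maximal_ideal_ideal)
      have "x \<in> Q \<or> y \<in> Q" using Q(2) xy(1) maximal_mult_iff[OF Q(1)] by blast
      then show "Q \<in> {Q. maximal_ideal Q \<and> {i + r * x | i r. i \<in> I} \<subseteq> Q} \<union> {Q. maximal_ideal Q \<and>
        {i + r * y | i r. i \<in> I} \<subseteq> Q}"
        using sub Q(1) by blast
    qed
    then show ?thesis using fin[OF xy(2)] fin[OF xy(3)] by (meson finite_UnI finite_subset)
  qed
qed

lemma finite_maximal_containing:
  assumes "(a :: 'a) \<noteq> 0"
  shows "finite {Q. maximal_ideal Q \<and> a \<in> Q}"
proof -
  have "is_ideal {x. a dvd x}" by (auto simp: is_ideal_def dvd_add)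
  moreover have "{x. a dvd x} \<noteq> {0}" using assms dvd_refl[of a] by blast
  ultimately have "finite {Q. maximal_ideal Q \<and> {x. a dvd x} \<subseteq> Q}" by (rule finite_maximal_over)
  moreover have "{Q. maximal_ideal Q \<and> a \<in> Q} \<subseteq> {Q. maximal_ideal Q \<and> {x. a dvd x} \<subseteq> Q}"
  proof
    fix Q assume "Q \<in> {Q. maximal_ideal Q \<and> a \<in> Q}"
    then show "Q \<in> {Q. maximal_ideal Q \<and> {x. a dvd x} \<subseteq> Q}"
      using ideal_dvd[of Q a] maximal_ideal_ideal[of Q] by auto
  qed
  ultimately show ?thesis by (rule rev_finite_subset)
qed

text \<open>An element \<open>z = b / a\<close> of the quotient field with \<open>z ^ k * a\<close> in the ring for all \<open>k\<close> is
  integral, because the ideals spanned by the first \<open>k\<close> of these elements become stationary.\<close>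

lemma almost_integral_imp_dvd:
  fixes a b :: 'a and w :: "nat \<Rightarrow> 'a"
  assumes a: "a \<noteq> 0" and w0: "w 0 = a" and w: "\<And>k. w k * b = a * w (Suc k)"
  shows "a dvd b"
proof -
  define I where "I k = {x. \<exists>r. x = (\<Sum>i<k. r i * w i)}" for k
  have I: "is_ideal (I k)" for k
    unfolding is_ideal_def
  proof (intro conjI ballI allI)
    show "0 \<in> I k" unfolding I_def by (intro CollectI exI[of _ "\<lambda>_. 0"]) simp
    fix x assume "x \<in> I k"
    then obtain r where x: "x = (\<Sum>i<k. r i * w i)" unfolding I_def by blast
    show "s * x \<in> I k" for s
      unfolding I_def x
      by (intro CollectI exI[of _ "\<lambda>i. s * r i"]) (simp add: sum_distrib_left mult.assoc)
    fix y assume "y \<in> I k"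
    then obtain s where y: "y = (\<Sum>i<k. s i * w i)" unfolding I_def by blast
    show "x + y \<in> I k"
      unfolding I_def x y
      by (intro CollectI exI[of _ "\<lambda>i. r i + s i"]) (simp add: sum.distrib distrib_right)
  qed
  have sub: "I k \<subseteq> I (Suc k)" for k
  proof
    fix x assume "x \<in> I k"
    then obtain r where x: "x = (\<Sum>i<k. r i * w i)" unfolding I_def by blast
    show "x \<in> I (Suc k)"
      unfolding I_def x by (intro CollectI exI[of _ "\<lambda>i. if i < k then r i else 0"]) simp
  qed
  have mem: "w k \<in> I (Suc k)" for k
    unfolding I_def by (intro CollectI exI[of _ "\<lambda>i. if i = k then 1 else 0"]) simp
  have "\<exists>k. w k \<in> I k"
  proof (rule ccontr)
    assume "\<nexists>k. w k \<in> I k"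
    then have "I k \<subset> I (Suc k)" for k using sub[of k] mem[of k] by blast
    then have "\<forall>k. (I (Suc k), I k) \<in> {(J, I). is_ideal I \<and> is_ideal J \<and> I \<subset> J}" using I by simp
    then show False using wf_ideals[OF noeth] unfolding wf_iff_no_infinite_down_chain by blast
  qed
  then obtain k r where k: "w k = (\<Sum>i<k. r i * w i)" unfolding I_def by blast
  define z where "z = to_fract b / to_fract a"
  have za: "to_fract (w i) = z ^ i * to_fract a" for i
  proof (induction i)
    case (Suc i)
    have "to_fract a * to_fract (w (Suc i)) = to_fract (w i) * to_fract b"
      unfolding to_fract_mult[symmetric] using w[of i] by simp
    then show ?case using a Suc by (simp add: z_def field_simps)
  qed (simp add: w0)
  \<comment> \<open>Dividing the relation \<open>k\<close> by \<open>a\<close> turns each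
    \<open>w i\<close> into \<open>z ^ i\<close>, so this monic polynomial vanishes at
    \<open>z\<close>.\<close>
  define p where "p = monom 1 k - (\<Sum>i<k. monom (r i) i)"
  have cp: "coeff p j = (if j = k then 1 else if j < k then - r j else 0)" for j
    unfolding p_def by (auto simp: coeff_sum)
  have "degree p = k" by (rule antisym) (auto simp: cp intro: degree_le le_degree)
  then have "lead_coeff p = 1" by (simp add: cp)
  moreover have "poly (map_poly emb p) z = 0"
  proof -
    have "to_fract a * poly (map_poly emb p) z =
      to_fract a * z ^ k - (\<Sum>i<k. to_fract (r i) * (z ^ i * to_fract a))"
      unfolding p_def emb_eq_to_fract fract_poly_diff poly_diff fract_poly_sum poly_sum
      by (simp add: map_poly_monom poly_monom right_diff_distrib sum_distrib_left ac_simps)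
    also have "\<dots> = to_fract (w k) - to_fract (\<Sum>i<k. r i * w i)"
      by (simp add: za to_fract_sum ac_simps)
    finally show ?thesis using a k by simp
  qed
  ultimately have "z \<in> range emb"
    using ded unfolding dedekind_domain_def integrally_closed_def by blast
  then obtain d where "z = to_fract d" by (auto simp: emb_eq_to_fract)
  then have "to_fract b = to_fract (d * a)" using a by (simp add: z_def field_simps)
  then show ?thesis by (simp only: to_fract_eq_iff) simp
qed

text \<open>Among the ideals \<open>{d. a dvd d * b}\<close> contained in \<open>Q\<close>, a maximal one is prime.\<close>

lemma colon_maximal:
  assumes Q: "maximal_ideal (Q :: 'a set)" and a: "a \<in> Q" "a \<noteq> 0"
  shows "\<exists>b. \<forall>d. a dvd d * b \<longleftrightarrow> d \<in> Q"
proof -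
  define colon where "colon b = {d. a dvd d * b}" for b
  have colon: "is_ideal (colon b)" for b
    by (auto simp: is_ideal_def colon_def distrib_right mult.assoc dvd_add)
  have "colon 1 \<subseteq> Q" using ideal_dvd[OF maximal_ideal_ideal[OF Q] a(1)] by (auto simp: colon_def)
  then have "colon 1 \<in> {colon b | b. colon b \<subseteq> Q}" by blast
  from wf_ideals[OF noeth, unfolded wf_eq_minimal, THEN spec, THEN spec, THEN mp, OF this]
  obtain J where J: "J \<in> {colon b | b. colon b \<subseteq> Q}"
    and min: "\<forall>J'. (J', J) \<in> {(J, I). is_ideal I \<and> is_ideal J \<and> I \<subset> J} \<longrightarrow>
      J' \<notin> {colon b | b. colon b \<subseteq> Q}" by (rule bexE)
  from J obtain b where b: "J = colon b" "colon b \<subseteq> Q" by blast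
  have max: "colon b' = colon b" if "colon b \<subseteq> colon b'" "colon b' \<subseteq> Q" for b'
  proof (rule ccontr)
    assume "colon b' \<noteq> colon b"
    then have "(colon b', J) \<in> {(J, I). is_ideal I \<and> is_ideal J \<and> I \<subset> J}"
      using that(1) b(1) colon by auto
    from min[THEN spec, THEN mp, OF this] show False using that(2) by blast
  qed
  have "prime_ideal (colon b)"
    unfolding prime_ideal_def
  proof (intro conjI allI impI colon)
    show "colon b \<noteq> UNIV" using b(2) Q by (auto simp: maximal_ideal_def)
    fix x y assume xy: "x * y \<in> colon b"
    show "x \<in> colon b \<or> y \<in> colon b"
    proof (cases "colon (b * x) \<subseteq> Q")
      case True
      have "colon b \<subseteq> colon (b * x)" by (auto simp: colon_def mult.assoc[symmetric])
      then have "colon (b * x) = colon b" using True max by blast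
      moreover have "y \<in> colon (b * x)" using xy by (simp add: colon_def ac_simps)
      ultimately show ?thesis by blast
    next
      case False
      then obtain s where s: "s \<in> colon (b * x)" "s \<notin> Q" by blast
      \<comment> \<open>Since \<open>s\<close> is outside the prime ideal \<open>Q\<close>, passing
        from \<open>b\<close> to \<open>b * s\<close> keeps the colon ideal inside \<open>Q\<close>;
        maximality makes it equal to \<open>colon b\<close>, and
        \<open>s \<in> colon (b * x)\<close> says that \<open>x\<close> belongs to it.\<close>
      have "colon b \<subseteq> colon (b * s)" by (auto simp: colon_def mult.assoc[symmetric])
      moreover have "colon (b * s) \<subseteq> Q"
      proof
        fix d assume "d \<in> colon (b * s)"
        then have "d * s \<in> colon b" by (simp add: colon_def ac_simps)
        then have "d * s \<in> Q" using b(2) by blast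
        then show "d \<in> Q" using s(2) by (simp add: maximal_mult_iff[OF Q])
      qed
      ultimately have "colon (b * s) = colon b" by (rule max)
      moreover have "x \<in> colon (b * s)" using s(1) by (simp add: colon_def ac_simps)
      ultimately show ?thesis by blast
    qed
  qed
  moreover have "a \<in> colon b" by (simp add: colon_def)
  ultimately have "maximal_ideal (colon b)" using a(2) prime_imp_maximal by blast
  then have "colon b = Q" using maximal_subset_eq[OF _ Q b(2)] by blast
  then show ?thesis unfolding colon_def by blast
qed

text \<open>In the localization at \<open>Q\<close>, the maximal ideal is generated by \<open>p\<close>.\<close>

lemma uniformizer:
  assumes Q: "maximal_ideal (Q :: 'a set)"
  shows "\<exists>p t. p \<in> Q \<and> t \<notin> Q \<and> p \<noteq> 0 \<and> (\<forall>y\<in>Q. p dvd t * y)"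
proof -
  obtain a where a: "a \<in> Q" "a \<noteq> 0" using maximal_nonzero[OF Q] by blast
  obtain b where b: "\<And>d. a dvd d * b \<longleftrightarrow> d \<in> Q" using colon_maximal[OF Q a] by blast
  \<comment> \<open>Otherwise multiplication by \<open>b / a\<close> maps \<open>Q\<close> into
    itself. Iterating it on \<open>a\<close> stays in the ring, so \<open>b / a\<close> is almost
    integral and \<open>a dvd b\<close>, which puts 1 into \<open>Q\<close>.\<close>
  have "\<exists>p\<in>Q. \<exists>t. t \<notin> Q \<and> p * b = a * t"
  proof (rule ccontr)
    assume contr: "\<not> (\<exists>p\<in>Q. \<exists>t. t \<notin> Q \<and> p * b = a * t)"
    have "\<exists>v. y \<in> Q \<longrightarrow> v \<in> Q \<and> y * b = a * v" for y
      using b[of y] contr unfolding dvd_def by blast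
    then obtain v where v: "\<And>y. y \<in> Q \<Longrightarrow> v y \<in> Q \<and> y * b = a * v y" by metis
    have "(v ^^ k) a \<in> Q" for k using a v by (induction k) auto
    then have "a dvd b"
      using v by (intro almost_integral_imp_dvd[of a "\<lambda>k. (v ^^ k) a"]) (auto simp: a)
    then show False using b[of 1] maximal_one_notin[OF Q] by simp
  qed
  then obtain p t where pt: "p \<in> Q" "t \<notin> Q" "p * b = a * t" by blast
  have "p dvd t * y" if "y \<in> Q" for y
  proof -
    obtain u where u: "y * b = a * u" using b[of y] \<open>y \<in> Q\<close> unfolding dvd_def by blast
    have "a * (t * y) = (p * b) * y" using pt(3) by simp
    also have "\<dots> = p * (y * b)" by (simp add: ac_simps)
    also have "\<dots> = a * (p * u)" using u by (simp add: ac_simps)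
    finally show ?thesis using a(2) by simp
  qed
  moreover have "p \<noteq> 0" using pt a ideal_zero[OF maximal_ideal_ideal[OF Q]] by auto
  ultimately show ?thesis using pt by blast
qed

text \<open>As long as \<open>c\<close> lies in \<open>Q\<close>, a factor \<open>p\<close> can be
  split off at the cost of the local unit \<open>t\<close>. This stops because the ideals
  \<open>J c\<close>, the contractions of \<open>(c)\<close> from the ring with \<open>t\<close>
  inverted, strictly increase.\<close>

lemma locassoc_power:
  assumes Q: "maximal_ideal (Q :: 'a set)" and p: "p \<in> Q" "t \<notin> Q" "p \<noteq> 0" "\<forall>y\<in>Q. p dvd t * y"
    and "c \<noteq> 0"
  shows "\<exists>e. locassoc Q c (p ^ e)"
proof -
  define J where "J c = {y. \<exists>i. c dvd t ^ i * y}" for c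
  have t0: "t \<noteq> 0" using p(2) ideal_zero[OF maximal_ideal_ideal[OF Q]] by auto
  have J: "is_ideal (J c)" for c
    unfolding is_ideal_def
  proof (intro conjI ballI allI)
    show "0 \<in> J c" by (simp add: J_def)
    fix x assume "x \<in> J c"
    then obtain i where i: "c dvd t ^ i * x" by (auto simp: J_def)
    show "r * x \<in> J c" for r
      unfolding J_def using i by (auto intro!: exI[of _ i] simp: mult.left_commute[of _ r])
    fix y assume "y \<in> J c"
    then obtain j where j: "c dvd t ^ j * y" by (auto simp: J_def)
    have "c dvd t ^ j * (t ^ i * x) + t ^ i * (t ^ j * y)" using i j by (meson dvd_add dvd_mult)
    then have "c dvd t ^ (i + j) * (x + y)" by (simp add: algebra_simps power_add)
    then show "x + y \<in> J c" unfolding J_def by blast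
  qed
  have "\<forall>c. I = J c \<longrightarrow> c \<noteq> 0 \<longrightarrow> (\<exists>e. locassoc Q c (p ^ e))" if "is_ideal I" for I
    using noeth that
  proof (induction I rule: noetherian_induct)
    case (step I)
    show ?case
    proof (intro allI impI)
      fix c assume I: "I = J c" and c: "c \<noteq> 0"
      show "\<exists>e. locassoc Q c (p ^ e)"
      proof (cases "c \<in> Q")
        case False
        then show ?thesis
          using maximal_one_notin[OF Q] unfolding locassoc_def
          by (intro exI[of _ 0] exI[of _ 1] exI[of _ c]) auto
      next
        case True
        then obtain c' where c': "t * c = p * c'" using p(4) by (auto simp: dvd_def)
        have "c' \<noteq> 0" using c' t0 c by auto
        have "J c \<subseteq> J c'"
        proof
          fix y assume "y \<in> J c"
          then obtain i where "c dvd t ^ i * y" by (auto simp: J_def)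
          then have "t * c dvd t ^ Suc i * y" by (simp add: mult.assoc mult_dvd_mono)
          moreover have "c' dvd t * c" using c' by simp
          ultimately have "c' dvd t ^ Suc i * y" by (rule dvd_trans[rotated])
          then show "y \<in> J c'" unfolding J_def by blast
        qed
        moreover have "c' \<in> J c'" unfolding J_def by simp
        moreover have "c' \<notin> J c"
        proof
          assume "c' \<in> J c"
          then obtain i r where "t ^ i * c' = c * r" by (auto simp: J_def dvd_def)
          then have "t ^ i * (p * c') = c * (p * r)" by (metis mult.left_commute)
          then have "c * t ^ Suc i = c * (p * r)" unfolding c'[symmetric] by (simp add: ac_simps)
          then have "t ^ Suc i = p * r" using c by (simp only: mult_cancel_left) simp
          moreover have "p * r \<in> Q" using p(1) Q by (simp add: maximal_mult_iff)
          ultimately show False using maximal_power[OF Q p(2), of "Suc i"] by simp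
        qed
        ultimately have "I \<subset> J c'" using I by blast
        then obtain e where "locassoc Q c' (p ^ e)" using step.IH[OF J] \<open>c' \<noteq> 0\<close> by blast
        then obtain s s' where s: "s \<notin> Q" "s' \<notin> Q" "s * c' = s' * p ^ e"
          by (auto simp: locassoc_def)
        have "(s * t) * c = p * (s * c')" using c' by (metis mult.assoc mult.left_commute)
        also have "\<dots> = s' * p ^ Suc e" using s(3) by simp
        finally have "(s * t) * c = s' * p ^ Suc e" .
        moreover have "s * t \<notin> Q" using s(1) p(2) Q by (simp add: maximal_mult_iff)
        ultimately show ?thesis using s(2) unfolding locassoc_def by blast
      qed
    qed
  qed
  then show ?thesis using J assms by blast
qed

text \<open>If \<open>e\<close> is the order of \<open>z\<close> at \<open>Q\<close>, then
  \<open>loc Q z\<close> contains \<open>y ^ e\<close> for every \<open>y \<in> Q\<close>, and some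
  such \<open>y\<close> is not in \<open>M\<close>. Hence these ideals are comaximal for different
  \<open>Q\<close>.\<close>

lemma loc_escape:
  assumes Q: "maximal_ideal (Q :: 'a set)" and M: "maximal_ideal M" "M \<noteq> Q" and z: "z \<noteq> 0"
  shows "\<exists>y\<in>loc Q z. y \<notin> M"
proof -
  obtain p t where p: "p \<in> Q" "t \<notin> Q" "p \<noteq> 0" "\<forall>y\<in>Q. p dvd t * y" using uniformizer[OF Q] by blast
  obtain e where e: "locassoc Q z (p ^ e)" using locassoc_power[OF Q p z] by blast
  obtain y where y: "y \<in> Q" "y \<notin> M" using maximal_subset_eq[OF Q M(1)] M(2) by blast
  have "y \<in> loc Q p" using p y by (intro locI[of t]) auto
  then have "y ^ e \<in> loc Q z" using loc_power[OF Q] locassoc_subset[OF Q e] by blast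
  then show ?thesis using maximal_power[OF M(1) y(2)] by blast
qed

text \<open>A product of elements of the other \<open>loc M z\<close> that avoid \<open>Q\<close> is
  a unit modulo \<open>loc Q z\<close>. Scaling it by the inverse gives \<open>e\<close>, congruent
  to 1 at \<open>Q\<close> and to 0 at the others, and these are combined linearly.\<close>

lemma loc_chinese_remainder:
  assumes fin: "finite \<Q>" and max: "\<And>Q. Q \<in> \<Q> \<Longrightarrow> maximal_ideal (Q :: 'a set)" and z: "z \<noteq> 0"
  shows "\<exists>x. \<forall>Q\<in>\<Q>. x - a Q \<in> loc Q z"
proof -
  have "\<exists>e. 1 - e \<in> loc Q z \<and> (\<forall>M\<in>\<Q> - {Q}. e \<in> loc M z)" if Q: "Q \<in> \<Q>" for Q
  proof -
    have "\<forall>M\<in>\<Q> - {Q}. \<exists>y. y \<in> loc M z \<and> y \<notin> Q"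
      using loc_escape max z Q by (metis DiffE singletonI)
    then obtain y where y: "\<And>M. M \<in> \<Q> - {Q} \<Longrightarrow> y M \<in> loc M z \<and> y M \<notin> Q" by metis
    have "\<exists>r. 1 - r * prod y (\<Q> - {Q}) \<in> loc Q z"
    proof (rule gen_coprime[OF noeth is_ideal_loc[OF max[OF Q]]])
      fix M assume M: "maximal_ideal M" "loc Q z \<subseteq> M"
      then have "M = Q" using loc_escape[OF max[OF Q] M(1) _ z] by blast
      then show "prod y (\<Q> - {Q}) \<notin> M" using y by (intro maximal_prod[OF M(1)]) auto
    qed
    then obtain r where r: "1 - r * prod y (\<Q> - {Q}) \<in> loc Q z" by blast
    moreover have "r * prod y (\<Q> - {Q}) \<in> loc M z" if "M \<in> \<Q> - {Q}" for M
      using that y fin is_ideal_loc[of M z] max[of M]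
      by (intro ideal_mult ideal_prod[where x = M]) auto
    ultimately show ?thesis by blast
  qed
  then obtain e where e: "\<And>Q. Q \<in> \<Q> \<Longrightarrow> 1 - e Q \<in> loc Q z"
    "\<And>Q M. Q \<in> \<Q> \<Longrightarrow> M \<in> \<Q> - {Q} \<Longrightarrow> e Q \<in> loc M z" by metis
  have "(\<Sum>M\<in>\<Q>. a M * e M) - a Q \<in> loc Q z" if Q: "Q \<in> \<Q>" for Q
  proof -
    have I: "is_ideal (loc Q z)" using max[OF Q] by (rule is_ideal_loc)
    have "(\<Sum>M\<in>\<Q>. a M * e M) - a Q = (\<Sum>M\<in>\<Q> - {Q}. a M * e M) - a Q * (1 - e Q)"
      using fin Q by (simp add: sum.remove algebra_simps)
    also have "\<dots> \<in> loc Q z"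
    proof (rule ideal_diff[OF I])
      show "(\<Sum>M\<in>\<Q> - {Q}. a M * e M) \<in> loc Q z"
        using e(2) Q by (intro ideal_sum[OF I] ideal_mult[OF I]) auto
      show "a Q * (1 - e Q) \<in> loc Q z" using e(1)[OF Q] by (rule ideal_mult[OF I])
    qed
    finally show ?thesis .
  qed
  then show ?thesis by blast
qed

text \<open>Only the coefficients below \<open>N\<close> are remaindered; since all targets are
  monic of the same degree, the top coefficient can be set to 1 exactly.\<close>

lemma monic_chinese_remainder:
  assumes "finite \<Q>" "\<And>Q. Q \<in> \<Q> \<Longrightarrow> maximal_ideal (Q :: 'a set)" "z \<noteq> 0"
    and h: "\<And>Q. Q \<in> \<Q> \<Longrightarrow> degree (h Q) = N \<and> lead_coeff (h Q) = 1"
  shows "\<exists>F. degree F = N \<and> lead_coeff F = 1 \<and> (\<forall>Q\<in>\<Q>. \<forall>k. coeff (F - h Q) k \<in> loc Q z)"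
proof -
  have "\<forall>k. \<exists>x. \<forall>Q\<in>\<Q>. x - coeff (h Q) k \<in> loc Q z"
    using loc_chinese_remainder[of \<Q> z "\<lambda>Q. coeff (h Q) _"] assms(1-3) by blast
  then obtain x where x: "\<And>k Q. Q \<in> \<Q> \<Longrightarrow> x k - coeff (h Q) k \<in> loc Q z" by metis
  define F where "F = monom 1 N + (\<Sum>k<N. monom (x k) k)"
  have F: "coeff F k = (if k < N then x k else if k = N then 1 else 0)" for k
    unfolding F_def by (auto simp: coeff_sum)
  have deg: "degree F = N" by (rule antisym) (auto simp: F intro: degree_le le_degree)
  have "coeff (F - h Q) k \<in> loc Q z" if Q: "Q \<in> \<Q>" for Q k
  proof (cases "k < N")
    case True
    then show ?thesis using x[OF Q] by (simp add: F)
  next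
    case False
    then have "coeff (F - h Q) k = 0"
      using h[OF Q] coeff_eq_0[of "h Q" k] by (cases "k = N") (auto simp: F)
    then show ?thesis using ideal_zero[OF is_ideal_loc[OF assms(2)[OF Q]]] by simp
  qed
  then show ?thesis using deg by (intro exI[of _ F]) (auto simp: F)
qed

end

section \<open>Irreducible polynomials with prescribed residues\<close>

lemma poly_cong_ideal:
  assumes "is_ideal I" "\<And>k. coeff (p - q) k \<in> I"
  shows "poly p x - poly q x \<in> I"
proof -
  have "poly p x - poly q x = poly (p - q) x" by simp
  also have "\<dots> \<in> I" unfolding poly_altdef using assms by (intro ideal_sum ideal_mult_right)
  finally show ?thesis .
qed

text \<open>This is the bound on the number of roots over the domain of residues modulo
  \<open>Q\<close>, obtained without forming that domain by splitting off \<open>[:- a, 1:]\<close>.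
  The leading coefficient outside \<open>Q\<close> survives each division.\<close>

lemma exists_nonroot_mod:
  fixes p :: "'a::comm_ring_1 poly"
  assumes Q: "prime_ideal Q" and E: "finite E" "\<And>a b. a \<in> E \<Longrightarrow> b \<in> E \<Longrightarrow> a \<noteq> b \<Longrightarrow> a - b \<notin> Q"
    and p: "lead_coeff p \<notin> Q" "degree p < card E"
  shows "\<exists>x\<in>E. poly p x \<notin> Q"
  using E p
proof (induction "degree p" arbitrary: p E)
  case 0
  then obtain x where "x \<in> E" by fastforce
  obtain a where "p = [:a:]" using 0(1) by (metis degree_eq_zeroE)
  then show ?case using 0 \<open>x \<in> E\<close> by auto
next
  case (Suc n)
  have I: "is_ideal Q" using Q by (simp add: prime_ideal_def)
  obtain a where a: "a \<in> E" using Suc.prems(4) by fastforce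
  define q where "q = synthetic_div p a"
  have pq: "p = [:- a, 1:] * q + [:poly p a:]"
    unfolding q_def by (rule synthetic_div_correct'[symmetric])
  have dq: "degree q = n" using Suc(2) by (simp add: q_def degree_synthetic_div)
  have "coeff p (Suc n) = coeff q n" by (subst pq) (simp add: coeff_eq_0 dq)
  then have lq: "lead_coeff q \<notin> Q" using Suc.prems(3) Suc(2) dq by simp
  have "\<exists>x\<in>E - {a}. poly q x \<notin> Q"
    using Suc.prems Suc(2) a dq by (intro Suc(1)[OF dq[symmetric]] lq) auto
  then obtain x where x: "x \<in> E" "x \<noteq> a" "poly q x \<notin> Q" by blast
  have "poly p x - poly p a = (x - a) * poly q x"
    by (subst pq) (simp add: algebra_simps)
  also have "\<dots> \<notin> Q" using Suc.prems(2)[OF x(1) a x(2)] x(3) prime_ideal_mult_iff[OF Q] by blast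
  finally have "poly p x - poly p a \<notin> Q" .
  then show ?case using x(1) a ideal_diff[OF I, of "poly p x" "poly p a"] by blast
qed

text \<open>With \<open>i\<close> and \<open>j\<close> the lowest indices of coefficients outside
  \<open>L\<close>, the product of these two is the only term of coefficient \<open>i + j\<close>
  outside \<open>L\<close>.\<close>

lemma prime_ideal_coeff_mult:
  fixes A B :: "'a::comm_ring_1 poly"
  assumes L: "prime_ideal L" and AB: "\<And>k. coeff (A * B) k \<in> L"
  shows "(\<forall>k. coeff A k \<in> L) \<or> (\<forall>k. coeff B k \<in> L)"
proof (rule ccontr)
  assume "\<not> ?thesis"
  then have ex: "\<exists>k. coeff A k \<notin> L" "\<exists>k. coeff B k \<notin> L" by auto
  have I: "is_ideal L" using L by (simp add: prime_ideal_def)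
  define i where "i = (LEAST k. coeff A k \<notin> L)"
  define j where "j = (LEAST k. coeff B k \<notin> L)"
  have i: "coeff A i \<notin> L" "\<And>k. k < i \<Longrightarrow> coeff A k \<in> L"
    using LeastI_ex[OF ex(1)] not_less_Least unfolding i_def by blast+
  have j: "coeff B j \<notin> L" "\<And>k. k < j \<Longrightarrow> coeff B k \<in> L"
    using LeastI_ex[OF ex(2)] not_less_Least unfolding j_def by blast+
  have "(\<Sum>k\<in>{..i + j} - {i}. coeff A k * coeff B (i + j - k)) \<in> L"
  proof (rule ideal_sum[OF I])
    fix k assume k: "k \<in> {..i + j} - {i}"
    show "coeff A k * coeff B (i + j - k) \<in> L"
    proof (cases "k < i")
      case True
      then show ?thesis using i(2) by (intro ideal_mult_right[OF I])
    next
      case False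
      then show ?thesis using k j(2) by (intro ideal_mult[OF I]) auto
    qed
  qed
  moreover have "coeff (A * B) (i + j) =
      coeff A i * coeff B j + (\<Sum>k\<in>{..i + j} - {i}. coeff A k * coeff B (i + j - k))"
    unfolding coeff_mult by (subst sum.remove[of _ i]) auto
  ultimately have "coeff A i * coeff B j \<in> L"
    using AB[of "i + j"] ideal_diff[OF I] by (metis add_diff_cancel_right')
  then show False using i(1) j(1) prime_ideal_mult_iff[OF L] by blast
qed

lemma fract_poly_clear_denominator:
  fixes A :: "'a::idom fract poly"
  shows "\<exists>d B. d \<noteq> 0 \<and> smult (to_fract d) A = map_poly to_fract B"
proof (induction A)
  case 0
  show ?case by (intro exI[of _ 1] exI[of _ 0]) auto
next
  case (pCons x A)
  then obtain d B where d: "d \<noteq> 0" "smult (to_fract d) A = map_poly to_fract B" by blast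
  obtain u v where x: "x = Fraction_Field.Fract u v" "v \<noteq> 0" by (cases x) auto
  have "to_fract v * x = to_fract u" using x by (simp add: to_fract_def eq_fract)
  then have "smult (to_fract (v * d)) (pCons x A) = map_poly to_fract (pCons (d * u) (smult v B))"
    using d(2) by (simp add: map_poly_pCons flip: smult_smult)
  then show ?case using d(1) x(2) by (metis mult_eq_0_iff)
qed

lemma finite_inj_into_infinite:
  assumes "finite A" "infinite B"
  shows "\<exists>f. inj_on f A \<and> f ` A \<subseteq> B"
proof -
  obtain B' where B': "finite B'" "card B' = card A" "B' \<subseteq> B"
    using infinite_arbitrarily_large[OF assms(2)] by blast
  then obtain f where "bij_betw f A B'" using assms(1) by (metis finite_same_card_bij)
  then show ?thesis using B'(3) by (auto simp: bij_betw_def)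
qed

section \<open>Eisenstein's criterion at a maximal ideal\<close>

context dedekind
begin

text \<open>The factors \<open>p\<close> are cancelled one at a time: all coefficients of
  \<open>A * B\<close> lie in \<open>L\<close>, hence all those of \<open>A\<close> or all those of
  \<open>B\<close>, and multiplication by \<open>t\<close> makes this factor divisible by
  \<open>p\<close>. The multiplier only collects elements outside \<open>L\<close>.\<close>

lemma local_gauss:
  assumes L: "maximal_ideal (L :: 'a set)" and p: "p \<in> L" "t \<notin> L" "p \<noteq> 0" "\<forall>y\<in>L. p dvd t * y"
    and "s \<notin> L" "smult (s * p ^ e) F = A * B"
  shows "\<exists>s A' B'. s \<notin> L \<and> smult s F = A' * B' \<and> degree A' = degree A \<and> degree B' = degree B"
  using assms(6,7)
proof (induction e arbitrary: s A B)
  case 0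
  then show ?case by auto
next
  case (Suc e)
  have t0: "t \<noteq> 0" using p(2) ideal_zero[OF maximal_ideal_ideal[OF L]] by auto
  have divide: "\<exists>C'. smult t C = smult p C'" if "\<forall>k. coeff C k \<in> L" for C :: "'a poly"
  proof -
    have "[:p:] dvd smult t C" using that p(4) by (simp add: const_poly_dvd_iff)
    then show ?thesis by (auto simp: dvd_def)
  qed
  have "coeff (A * B) k \<in> L" for k
  proof -
    have "coeff (A * B) k = p * (s * p ^ e * coeff F k)"
      unfolding Suc.prems(2)[symmetric] by (simp add: ac_simps)
    then show ?thesis using p(1) by (simp add: maximal_mult_iff[OF L])
  qed
  from prime_ideal_coeff_mult[OF maximal_imp_prime[OF L] this]
  show ?case
  proof
    assume "\<forall>k. coeff A k \<in> L"
    then obtain A' where A': "smult t A = smult p A'" using divide by blast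
    have "smult p (smult (t * s * p ^ e) F) = smult t (smult (s * p ^ Suc e) F)"
      by (simp add: ac_simps)
    also have "\<dots> = smult t A * B" unfolding Suc.prems(2) by simp
    finally have "smult p (smult (t * s * p ^ e) F) = smult t A * B" .
    then have "smult p (smult (t * s * p ^ e) F) = smult p (A' * B)" using A' by simp
    then have "smult (t * s * p ^ e) F = A' * B" using p(3) by (metis smult_cancel)
    moreover have "t * s \<notin> L" using p(2) Suc.prems(1) by (simp add: maximal_mult_iff[OF L])
    moreover have "degree A' = degree A" using A' t0 p(3) by (metis degree_smult_eq)
    ultimately show ?thesis using Suc.IH[of "t * s" A' B] by metis
  next
    assume "\<forall>k. coeff B k \<in> L"
    then obtain B' where B': "smult t B = smult p B'" using divide by blast
    have "smult p (smult (t * s * p ^ e) F) = smult t (smult (s * p ^ Suc e) F)"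
      by (simp add: ac_simps)
    also have "\<dots> = A * smult t B" unfolding Suc.prems(2) by simp
    finally have "smult p (smult (t * s * p ^ e) F) = A * smult t B" .
    then have "smult p (smult (t * s * p ^ e) F) = smult p (A * B')" using B' by simp
    then have "smult (t * s * p ^ e) F = A * B'" using p(3) by (metis smult_cancel)
    moreover have "t * s \<notin> L" using p(2) Suc.prems(1) by (simp add: maximal_mult_iff[OF L])
    moreover have "degree B' = degree B" using B' t0 p(3) by (metis degree_smult_eq)
    ultimately show ?thesis using Suc.IH[of "t * s" A B'] by metis
  qed
qed

text \<open>The lowest coefficient of \<open>A\<close> outside \<open>L\<close> meets
  \<open>coeff B 0\<close> in a coefficient of the product that is outside \<open>L\<close>. By
  \<open>co\<close> its index is at least the degree of \<open>F\<close>, which leaves no degree for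
  \<open>B\<close>.\<close>

lemma eisenstein_step:
  assumes L: "maximal_ideal (L :: 'a set)" and s: "s \<notin> L" and F: "smult s F = A * B"
    and co: "\<And>k. k < degree F \<Longrightarrow> coeff F k \<in> L" and A0: "coeff A 0 \<in> L" and B0: "coeff B 0 \<notin> L"
    and lead: "lead_coeff F = 1"
  shows "degree B = 0"
proof -
  have I: "is_ideal L" using L by (rule maximal_ideal_ideal)
  have s0: "s \<noteq> 0" using s ideal_zero[OF I] by auto
  have F0: "F \<noteq> 0" using lead by auto
  then have nz: "A \<noteq> 0" "B \<noteq> 0" using F s0 by auto
  have deg: "degree F = degree A + degree B"
    using F nz s0 by (metis degree_mult_eq degree_smult_eq)
  have "lead_coeff A * lead_coeff B = s"
    using F lead by (metis lead_coeff_mult lead_coeff_smult mult.right_neutral)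
  then have ex: "\<exists>k. coeff A k \<notin> L" using s by (metis ideal_mult_right[OF I])
  define k where "k = (LEAST k. coeff A k \<notin> L)"
  have k: "coeff A k \<notin> L" "\<And>i. i < k \<Longrightarrow> coeff A i \<in> L"
    using LeastI_ex[OF ex] not_less_Least unfolding k_def by blast+
  have "coeff (A * B) k = coeff A k * coeff B 0 + (\<Sum>i\<in>{..k} - {k}. coeff A i * coeff B (k - i))"
    unfolding coeff_mult by (subst sum.remove[of _ k]) auto
  moreover have "(\<Sum>i\<in>{..k} - {k}. coeff A i * coeff B (k - i)) \<in> L"
    using k(2) by (intro ideal_sum[OF I] ideal_mult_right[OF I]) auto
  moreover have "coeff A k * coeff B 0 \<notin> L" using k(1) B0 by (simp add: maximal_mult_iff[OF L])
  ultimately have "coeff (A * B) k \<notin> L"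
    using ideal_diff[OF I] by (metis add_diff_cancel_right')
  then have "coeff F k \<notin> L" unfolding F[symmetric] by (simp add: maximal_mult_iff[OF L])
  then have "\<not> k < degree F" using co by blast
  moreover have "k \<le> degree A" using k(1) ideal_zero[OF I] by (metis le_degree)
  ultimately show ?thesis using deg by simp
qed

text \<open>The ring need not be factorial, so a factorization over the quotient field is brought
  down only up to a multiplier \<open>r\<close> outside \<open>L\<close>; this is enough, because
  the criterion only inspects coefficients locally at \<open>L\<close>.\<close>

lemma eisenstein:
  assumes L: "maximal_ideal (L :: 'a set)" and p: "p \<in> L" "t \<notin> L" "p \<noteq> 0" "\<forall>y\<in>L. p dvd t * y"
    and F: "degree F \<ge> 1" "lead_coeff F = 1" and co: "\<And>k. k < degree F \<Longrightarrow> coeff F k \<in> L"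
    and c0: "coeff F 0 \<notin> loc L (p\<^sup>2)"
  shows "irreducible (map_poly to_fract F)"
proof (rule irreducibleI)
  have F0: "F \<noteq> 0" using F(1) by auto
  have degF: "degree (map_poly to_fract F) = degree F" by (rule degree_map_poly) simp
  show "map_poly to_fract F \<noteq> 0" using F0 by simp
  show "\<not> is_unit (map_poly to_fract F)"
    using F(1) degF is_unit_polyE by (metis degree_pCons_0 not_one_le_zero)
  fix A B assume AB: "map_poly to_fract F = A * B"
  have nz: "A \<noteq> 0" "B \<noteq> 0" using AB F0 by auto
  obtain d A' where A': "d \<noteq> 0" "smult (to_fract d) A = map_poly to_fract A'"
    using fract_poly_clear_denominator by blast
  obtain d' B' where B': "d' \<noteq> 0" "smult (to_fract d') B = map_poly to_fract B'"
    using fract_poly_clear_denominator by blast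
  have dA: "degree A' = degree A"
    using A' by (metis degree_map_poly degree_smult_eq to_fract_eq_0_iff)
  have dB: "degree B' = degree B"
    using B' by (metis degree_map_poly degree_smult_eq to_fract_eq_0_iff)
  have "map_poly to_fract (smult (d * d') F) = map_poly to_fract (A' * B')"
    using A'(2)[symmetric] B'(2)[symmetric] AB by (simp add: ac_simps)
  then have dF: "smult (d * d') F = A' * B'" by (simp only: fract_poly_eq_iff)
  obtain e where "locassoc L (d * d') (p ^ e)"
    using locassoc_power[OF L p, of "d * d'"] A'(1) B'(1) by auto
  then obtain s s' where s: "s \<notin> L" "s' \<notin> L" "s * (d * d') = s' * p ^ e"
    by (auto simp: locassoc_def)
  have "smult (s' * p ^ e) F = smult s A' * B'"
    unfolding s(3)[symmetric] using dF by (simp flip: smult_smult)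
  from local_gauss[OF L p s(2) this] obtain r A2 B2 where r: "r \<notin> L" "smult r F = A2 * B2"
    "degree A2 = degree (smult s A')" "degree B2 = degree B'" by blast
  have "s \<noteq> 0" using s(1) ideal_zero[OF maximal_ideal_ideal[OF L]] by auto
  then have deg: "degree A2 = degree A" "degree B2 = degree B" using r dA dB by auto
  have c: "coeff A2 0 * coeff B2 0 = r * coeff F 0"
    unfolding coeff_mult_0[symmetric] r(2)[symmetric] by simp
  have "coeff F 0 \<in> L" using co F(1) by simp
  then have "coeff A2 0 * coeff B2 0 \<in> L" unfolding c by (simp add: maximal_mult_iff[OF L])
  then consider "coeff A2 0 \<in> L" "coeff B2 0 \<in> L" | "coeff A2 0 \<in> L" "coeff B2 0 \<notin> L"
    | "coeff A2 0 \<notin> L" "coeff B2 0 \<in> L" unfolding maximal_mult_iff[OF L] by blast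
  then have "degree A = 0 \<or> degree B = 0"
  proof cases
    case 1
    \<comment> \<open>Each constant coefficient becomes divisible by \<open>p\<close> after
      multiplication by \<open>t\<close>, so that of \<open>F\<close> would be locally divisible by
      \<open>p\<^sup>2\<close>, against \<open>c0\<close>.\<close>
    then have "p * p dvd (t * coeff A2 0) * (t * coeff B2 0)"
      using p(4) by (intro mult_dvd_mono) auto
    also have "\<dots> = t * t * r * coeff F 0" using c by (simp add: ac_simps)
    finally have "coeff F 0 \<in> loc L (p\<^sup>2)"
      using p(2) r(1) by (intro locI[of "t * t * r"]) (auto simp: maximal_mult_iff[OF L] power2_eq_square)
    then show ?thesis using c0 by blast
  next
    case 2
    then show ?thesis using eisenstein_step[OF L r(1,2) co _ _ F(2)] deg by simp
  next
    case 3
    then show ?thesis using eisenstein_step[OF L r(1) _ co _ _ F(2), of B2 A2] r(2) deg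
      by (simp add: mult.commute)
  qed
  then show "is_unit A \<or> is_unit B" using nz is_unit_iff_degree by blast
qed

text \<open>Each \<open>F i\<close> is made Eisenstein at a maximal ideal \<open>L i\<close> of its own, at which the other members are
  not; this also makes the members distinct.\<close>

lemma irreducible_family:
  assumes inf: "infinite {P::'a set. maximal_ideal P}"
    and I: "finite I" and N: "N \<ge> 1"
    and Q: "finite \<Q>" "\<And>Q. Q \<in> \<Q> \<Longrightarrow> maximal_ideal (Q :: 'a set)" and z: "z \<noteq> 0"
    and h: "\<And>i Q. i \<in> I \<Longrightarrow> Q \<in> \<Q> \<Longrightarrow> degree (h i Q) = N \<and> lead_coeff (h i Q) = 1"
  shows "\<exists>F. inj_on F I \<and> (\<forall>i\<in>I. degree (F i) = N \<and> lead_coeff (F i) = 1 \<and>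
    irreducible (map_poly to_fract (F i)) \<and> (\<forall>Q\<in>\<Q>. \<forall>k. coeff (F i - h i Q) k \<in> loc Q z))"
proof -
  have "infinite ({P. maximal_ideal P} - \<Q>)" using inf Q(1) by (rule Diff_infinite_finite[rotated])
  then obtain L where L: "inj_on L I" "L ` I \<subseteq> {P. maximal_ideal P} - \<Q>"
    using finite_inj_into_infinite[OF I] by blast
  have Lmax: "maximal_ideal (L i)" "L i \<notin> \<Q>" if "i \<in> I" for i
    using L(2) that by auto
  have Leq: "L i = L j \<longleftrightarrow> i = j" if "i \<in> I" "j \<in> I" for i j
    using L(1) that by (auto dest: inj_onD)
  have "\<forall>i\<in>I. \<exists>p t. p \<in> L i \<and> t \<notin> L i \<and> p \<noteq> 0 \<and> (\<forall>y\<in>L i. p dvd t * y)"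
    using uniformizer Lmax(1) by blast
  then obtain p t where p: "\<And>i. i \<in> I \<Longrightarrow> p i \<in> L i \<and> t i \<notin> L i \<and> p i \<noteq> 0 \<and> (\<forall>y\<in>L i. p i dvd t i * y)"
    by metis
  \<comment> \<open>A single modulus that is fine enough both for the prescribed targets modulo
    \<open>z\<close> and for the Eisenstein condition modulo \<open>(p i)\<^sup>2\<close> at each
    \<open>L i\<close>.\<close>
  define w where "w = z * (\<Prod>i\<in>I. (p i)\<^sup>2)"
  have w0: "w \<noteq> 0" using z p I by (simp add: w_def)
  \<comment> \<open>At \<open>L i\<close> the target of \<open>F i\<close> has constant coefficient
    \<open>p i\<close>, while for the other members it is 0; the two differ modulo
    \<open>(p i)\<^sup>2\<close>. As \<open>L i\<close> is outside \<open>\<Q>\<close>, this does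
    not clash with \<open>h\<close>.\<close>
  define g where "g i Q = (if Q \<in> \<Q> then h i Q else monom 1 N + (if Q = L i then [:p i:] else 0))"
    for i Q
  have g: "degree (g i Q) = N \<and> lead_coeff (g i Q) = 1" if "i \<in> I" for i Q
  proof (cases "Q \<in> \<Q>")
    case False
    have "degree (monom 1 N + (if Q = L i then [:p i:] else 0)) = N"
      using N by (subst degree_add_eq_left) (auto simp: degree_monom_eq)
    then show ?thesis using False N by (auto simp: g_def coeff_pCons split: nat.split)
  qed (use h that in \<open>auto simp: g_def\<close>)
  have "\<exists>F. degree F = N \<and> lead_coeff F = 1 \<and> (\<forall>Q\<in>\<Q> \<union> L ` I. \<forall>k. coeff (F - g i Q) k \<in> loc Q w)"
    if "i \<in> I" for i
    using L(2) I Q w0 by (intro monic_chinese_remainder g[OF that]) auto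
  then obtain F where F: "\<And>i. i \<in> I \<Longrightarrow> degree (F i) = N" "\<And>i. i \<in> I \<Longrightarrow> lead_coeff (F i) = 1"
    "\<And>i Q k. i \<in> I \<Longrightarrow> Q \<in> \<Q> \<union> L ` I \<Longrightarrow> coeff (F i - g i Q) k \<in> loc Q w" by metis
  have FL: "coeff (F i - g i (L j)) k \<in> loc (L j) ((p j)\<^sup>2)" if "i \<in> I" "j \<in> I" for i j k
  proof -
    have "(p j)\<^sup>2 dvd w" unfolding w_def using I that(2) by (intro dvd_mult dvd_prodI)
    moreover have "L j \<in> L ` I" using that(2) by blast
    ultimately show ?thesis using F(3)[OF that(1), of "L j" k] loc_antimono by blast
  qed
  have psub: "loc (L i) ((p i)\<^sup>2) \<subseteq> L i" if "i \<in> I" for i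
    using that Lmax(1) p by (intro loc_subset) (auto simp: power2_eq_square maximal_mult_iff)
  have F0: "coeff (F i) 0 \<notin> loc (L i) ((p i)\<^sup>2)" if i: "i \<in> I" for i
  proof
    assume "coeff (F i) 0 \<in> loc (L i) ((p i)\<^sup>2)"
    moreover have "coeff (F i) 0 - p i \<in> loc (L i) ((p i)\<^sup>2)"
      using FL[OF i i, of 0] Lmax(2)[OF i] N by (simp add: g_def)
    ultimately have "p i \<in> loc (L i) ((p i)\<^sup>2)"
      using ideal_mem_cong[OF is_ideal_loc[OF Lmax(1)[OF i]]] by blast
    then obtain s k where s: "s \<notin> L i" "s * p i = (p i)\<^sup>2 * k" by (auto simp: loc_def dvd_def)
    then have "p i * s = p i * (p i * k)" by (simp add: power2_eq_square ac_simps)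
    then have "s = p i * k" using p[OF i] by simp
    then show False using s(1) p[OF i] Lmax(1)[OF i] by (simp add: maximal_mult_iff)
  qed
  have "inj_on F I"
  proof (rule inj_onI, rule ccontr)
    fix i j assume ij: "i \<in> I" "j \<in> I" "F i = F j" "i \<noteq> j"
    have "coeff (F j) 0 \<in> loc (L i) ((p i)\<^sup>2)"
      using FL[OF ij(2,1), of 0] Lmax(2)[OF ij(1)] N Leq[OF ij(1,2)] ij(4) by (simp add: g_def)
    then show False using F0[OF ij(1)] ij(3) by simp
  qed
  moreover have "irreducible (map_poly to_fract (F i))" if i: "i \<in> I" for i
  proof (rule eisenstein[OF Lmax(1)[OF i], of "p i" "t i"])
    show "1 \<le> degree (F i)" "lead_coeff (F i) = 1" using F(1,2)[OF i] N by auto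
    show "coeff (F i) 0 \<notin> loc (L i) ((p i)\<^sup>2)" by (rule F0[OF i])
    fix k assume k: "k < degree (F i)"
    have "coeff (F i - g i (L i)) k \<in> L i" using FL[OF i i] psub[OF i] by blast
    moreover have "coeff (g i (L i)) k \<in> L i"
      using k F(1)[OF i] Lmax[OF i] p[OF i] ideal_zero[OF maximal_ideal_ideal[OF Lmax(1)[OF i]]]
      by (auto simp: g_def coeff_pCons split: nat.split)
    ultimately show "coeff (F i) k \<in> L i"
      using ideal_add[OF maximal_ideal_ideal[OF Lmax(1)[OF i]]] by fastforce
  qed (use p[OF i] in auto)
  moreover have "coeff (F i - h i Q) k \<in> loc Q z" if "i \<in> I" "Q \<in> \<Q>" for i Q k
    using F(3)[of i Q k] that loc_antimono[of z w Q] by (auto simp: g_def w_def)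
  ultimately show ?thesis using F(1,2) by blast
qed

section \<open>Polynomials with a prescribed fixed divisor at one maximal ideal\<close>

lemma residue_representatives:
  assumes Q: "maximal_ideal (Q :: 'a set)" and fin: "finite (residue_classes Q)"
  shows "\<exists>R. finite R \<and> (\<forall>x. \<exists>r\<in>R. x - r \<in> Q) \<and> (\<forall>r\<in>R. \<forall>r'\<in>R. r - r' \<in> Q \<longrightarrow> r = r')"
proof -
  have I: "is_ideal Q" using Q by (rule maximal_ideal_ideal)
  define cl where "cl a = {a + p | p. p \<in> Q}" for a
  define rep where "rep C = (SOME r. r \<in> C)" for C :: "'a set"
  have cl: "y \<in> cl x \<longleftrightarrow> y - x \<in> Q" for x y unfolding cl_def by (auto intro: exI[of _ "y - x"])
  have "x \<in> cl x" for x using ideal_zero[OF I] by (simp add: cl)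
  then have "rep (cl x) \<in> cl x" for x unfolding rep_def by (rule someI)
  then have rep: "rep (cl x) - x \<in> Q" for x by (simp add: cl)
  have cleq: "cl x = cl y" if "x - y \<in> Q" for x y
    using ideal_diff_trans[OF I _ that] ideal_diff_trans[OF I _ ideal_diff_commute[OF I that]]
    by (auto simp: cl)
  define R where "R = rep ` range cl"
  have "residue_classes Q = range cl" by (simp add: residue_classes_def cl_def[abs_def])
  then have "finite R" using fin by (simp add: R_def)
  moreover have "\<forall>x. \<exists>r\<in>R. x - r \<in> Q" using ideal_diff_commute[OF I rep] unfolding R_def by blast
  moreover have "r = r'" if r: "r \<in> R" "r' \<in> R" "r - r' \<in> Q" for r r'
  proof -
    obtain x x' where x: "r = rep (cl x)" "r' = rep (cl x')" using r(1,2) unfolding R_def by blast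
    have "x - x' \<in> Q" using rep[of x] rep[of x'] r(3) x
      by (metis I ideal_diff_commute ideal_diff_trans)
    then show ?thesis using cleq x by simp
  qed
  ultimately show ?thesis by blast
qed

text \<open>The power \<open>p ^ e\<close> is attained exactly at \<open>r + p\<close>, where \<open>r\<close> represents the class of \<open>1\<close>.\<close>

lemma local_fixed_divisor_poly:
  assumes Q: "maximal_ideal (Q :: 'a set)" and fin: "finite (residue_classes Q)"
    and p: "p \<in> Q" "t \<notin> Q" "\<forall>y\<in>Q. p dvd t * y"
    and B: "\<And>b. b \<in> B \<Longrightarrow> 1 - b \<notin> Q"
  shows "\<exists>h. lead_coeff h = 1 \<and>
    (\<forall>x. (\<forall>b\<in>B. x - b \<notin> Q) \<longrightarrow> poly h x \<in> loc Q (p ^ e)) \<and>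
    (\<forall>x. \<forall>b\<in>B. x - b \<in> Q \<longrightarrow> poly h x \<notin> Q) \<and>
    (\<exists>x. x - 1 \<in> Q \<and> locassoc Q (p ^ e) (poly h x))"
proof -
  have I: "is_ideal Q" using Q by (rule maximal_ideal_ideal)
  obtain R where R: "finite R" "\<And>x. \<exists>r\<in>R. x - r \<in> Q" "\<And>r r'. r \<in> R \<Longrightarrow> r' \<in> R \<Longrightarrow> r - r' \<in> Q \<Longrightarrow> r = r'"
    using residue_representatives[OF Q fin] by metis
  define R' where "R' = {r \<in> R. \<forall>b\<in>B. r - b \<notin> Q}"
  have "finite R'" using R(1) by (simp add: R'_def)
  \<comment> \<open>There is one linear factor for each class not met by \<open>B\<close>: in these
    classes exactly one factor has its value in \<open>Q\<close>, and in the classes of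
    \<open>B\<close> none does.\<close>
  define h where "h = (\<Prod>r\<in>R'. [:- r, 1:]) ^ e"
  have lead: "lead_coeff h = 1" unfolding h_def by (simp add: lead_coeff_power lead_coeff_prod)
  have ev: "poly h x = (\<Prod>r\<in>R'. x - r) ^ e" for x
    unfolding h_def by (simp add: poly_prod)
  have "poly h x \<in> loc Q (p ^ e)" if x: "\<forall>b\<in>B. x - b \<notin> Q" for x
  proof -
    obtain r where r: "r \<in> R" "x - r \<in> Q" using R(2) by blast
    have "r \<in> R'" using r x ideal_diff_trans[OF I r(2)] unfolding R'_def by blast
    then have "(\<Prod>r\<in>R'. x - r) \<in> Q" using r(2) \<open>finite R'\<close> by (intro ideal_prod[OF I]) auto
    then have "(\<Prod>r\<in>R'. x - r) \<in> loc Q p" using p by (intro locI[of t]) auto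
    then show ?thesis unfolding ev by (rule loc_power[OF Q])
  qed
  moreover have "poly h x \<notin> Q" if b: "b \<in> B" "x - b \<in> Q" for x b
    unfolding ev
  proof (intro maximal_power[OF Q] maximal_prod[OF Q] notI)
    fix r assume r: "r \<in> R'" "x - r \<in> Q"
    have "r - b \<in> Q" using ideal_diff_trans[OF I ideal_diff_commute[OF I r(2)] b(2)] .
    then show False using r(1) b(1) unfolding R'_def by blast
  qed
  moreover have "\<exists>x. x - 1 \<in> Q \<and> locassoc Q (p ^ e) (poly h x)"
  proof -
    obtain r where r: "r \<in> R" "1 - r \<in> Q" using R(2) by blast
    have "r \<in> R'"
      unfolding R'_def
    proof (intro CollectI conjI ballI notI r(1))
      fix b assume "b \<in> B" "r - b \<in> Q"
      then show False using B ideal_diff_trans[OF I r(2)] by blast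
    qed
    \<comment> \<open>At \<open>r + p\<close> the factor belonging to \<open>r\<close> has value
      exactly \<open>p\<close>; the remaining factors form \<open>u\<close>, outside
      \<open>Q\<close> because the representatives are incongruent.\<close>
    define u where "u = (\<Prod>r'\<in>R' - {r}. (r + p) - r')"
    have "u \<notin> Q"
      unfolding u_def
    proof (intro maximal_prod[OF Q] notI)
      fix r' assume r': "r' \<in> R' - {r}" "r + p - r' \<in> Q"
      have "r - r' = (r + p - r') - p" by simp
      also have "\<dots> \<in> Q" using r'(2) p(1) by (rule ideal_diff[OF I])
      finally show False using R(3)[of r r'] r(1) r'(1) unfolding R'_def by blast
    qed
    have "(\<Prod>r'\<in>R'. (r + p) - r') = p * u"
      unfolding u_def using \<open>finite R'\<close> \<open>r \<in> R'\<close> by (subst prod.remove) auto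
    then have "poly h (r + p) = p ^ e * u ^ e" unfolding ev by (simp add: power_mult_distrib)
    then have "locassoc Q (p ^ e) (poly h (r + p))"
      unfolding locassoc_def using maximal_power[OF Q \<open>u \<notin> Q\<close>] maximal_one_notin[OF Q]
      by (intro exI[of _ "u ^ e"] exI[of _ 1]) (auto simp: mult.commute)
    moreover have "r + p - 1 \<in> Q"
    proof -
      have eq: "r + p - 1 = p - (1 - r)" by (simp add: algebra_simps)
      show ?thesis unfolding eq using p(1) r(2) by (rule ideal_diff[OF I])
    qed
    ultimately show ?thesis by blast
  qed
  ultimately show ?thesis using lead by blast
qed

end

lemma poly_fract_poly: "poly (map_poly to_fract p) (to_fract x) = to_fract (poly p x)"
  by (induction p) (auto simp: map_poly_pCons)

section \<open>Factorizations of integer-valued polynomials\<close>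

lemma IntD_iff: "f \<in> IntD \<longleftrightarrow> (\<forall>a. \<exists>b. poly f (to_fract a) = to_fract b)"
  by (auto simp: IntD_def emb_eq_to_fract image_def)

lemma IntD_mult: "f \<in> IntD \<Longrightarrow> g \<in> IntD \<Longrightarrow> f * g \<in> IntD"
  unfolding IntD_iff by (metis poly_mult to_fract_mult)

lemma IntD_prod_list: "(\<And>f. f \<in> set fs \<Longrightarrow> f \<in> IntD) \<Longrightarrow> prod_list fs \<in> IntD"
proof (induction fs)
  case Nil
  show ?case unfolding IntD_iff by (metis poly_1 prod_list.Nil to_fract_1)
next
  case (Cons f fs)
  then show ?case by (auto intro: IntD_mult)
qed

section \<open>Units of \<open>IntD\<close> and essentially equal factorizations\<close>

definition const_unit :: "'a::idom fract \<Rightarrow> bool" where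
  "const_unit x \<longleftrightarrow> (\<exists>a b. x = to_fract a \<and> a * b = 1)"

lemma const_unit_1: "const_unit 1"
  unfolding const_unit_def by (intro exI[of _ 1]) simp

lemma const_unit_nonzero: "const_unit x \<Longrightarrow> x \<noteq> 0"
  by (auto simp: const_unit_def)

lemma const_unit_inverse: "const_unit x \<Longrightarrow> const_unit (inverse x)"
proof -
  assume "const_unit x"
  then obtain a b where ab: "x = to_fract a" "a * b = 1" by (auto simp: const_unit_def)
  then have "x * to_fract b = 1" by (simp flip: to_fract_mult)
  then have "inverse x = to_fract b" by (rule inverse_unique)
  then show ?thesis unfolding const_unit_def using ab(2) by (metis mult.commute)
qed

lemma const_unit_factor:
  assumes "const_unit (to_fract a * to_fract b)"
  shows "const_unit (to_fract a)"
proof -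
  obtain d e where "to_fract a * to_fract b = to_fract d" "d * e = 1"
    using assms by (auto simp: const_unit_def)
  then have "a * b * e = 1" by (simp flip: to_fract_mult)
  then have "a * (b * e) = 1" by (simp only: mult.assoc)
  then show ?thesis unfolding const_unit_def by blast
qed

lemma unit_in_IntD_iff: "unit_in IntD f \<longleftrightarrow> (\<exists>x. f = [:x:] \<and> const_unit x)"
proof
  assume "unit_in IntD f"
  then obtain g where g: "f \<in> IntD" "g \<in> IntD" "f * g = 1" by (auto simp: unit_in_def)
  then have "f dvd 1" "g dvd 1" by (metis dvd_triv_left dvd_triv_right)+
  then obtain x y where xy: "f = [:x:]" "g = [:y:]" by (auto simp: is_unit_poly_iff)
  obtain a b where ab: "x = to_fract a" "y = to_fract b" using g(1,2) xy unfolding IntD_iff by auto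
  have "to_fract (a * b) = to_fract 1" using g(3) xy ab by (simp add: one_pCons mult.commute)
  then have "a * b = 1" by (simp only: to_fract_eq_iff)
  then show "\<exists>x. f = [:x:] \<and> const_unit x" using xy ab unfolding const_unit_def by blast
next
  assume "\<exists>x. f = [:x:] \<and> const_unit x"
  then obtain a b where ab: "f = [:to_fract a:]" "a * b = 1" by (auto simp: const_unit_def)
  have "[:to_fract d:] \<in> IntD" for d :: 'a unfolding IntD_iff by auto
  moreover have "[:to_fract a:] * [:to_fract b:] = 1"
    using ab(2) by (simp add: one_pCons mult.commute flip: to_fract_mult)
  ultimately show "unit_in IntD f" unfolding unit_in_def ab(1) by blast
qed

lemma unit_in_IntD_degree: "unit_in IntD f \<Longrightarrow> degree f = 0"
  by (auto simp: unit_in_IntD_iff)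

lemma ess_same_in_permI:
  assumes "fs <~~> gs" "length hs = length gs"
    and "\<And>j. j < length gs \<Longrightarrow> \<exists>u. unit_in R u \<and> gs ! j = u * hs ! j"
  shows "ess_same_in R fs hs"
proof -
  obtain f where f: "bij_betw f {..<length fs} {..<length gs}" "\<forall>i<length fs. fs ! i = gs ! (f i)"
    using permutation_Ex_bij[OF assms(1)] by blast
  have len: "length fs = length gs" using assms(1) by (metis mset_eq_length)
  show ?thesis
    unfolding ess_same_in_def
  proof (intro conjI exI[of _ f] allI impI)
    show "length fs = length hs" "bij_betw f {..<length fs} {..<length fs}"
      using f(1) len assms(2) by simp_all
    fix j assume j: "j < length fs"
    then have "f j < length gs" using f(1) by (auto simp: bij_betw_def)
    then show "\<exists>u. unit_in R u \<and> fs ! j = u * hs ! f j" using assms(3) f(2) j by simp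
  qed
qed

lemma ess_same_in_member:
  assumes "ess_same_in R fs gs" "f \<in> set fs"
  shows "\<exists>g\<in>set gs. \<exists>u. unit_in R u \<and> f = u * g"
proof -
  obtain j where j: "j < length fs" "f = fs ! j" using assms(2) by (auto simp: in_set_conv_nth)
  obtain \<sigma> where s: "length fs = length gs" "bij_betw \<sigma> {..<length fs} {..<length fs}"
    "\<forall>j<length fs. \<exists>u. unit_in R u \<and> fs ! j = u * gs ! (\<sigma> j)"
    using assms(1) unfolding ess_same_in_def by blast
  have "\<sigma> j < length gs" using s(1,2) j(1) by (auto simp: bij_betw_def)
  then show ?thesis using s(3) j by (metis nth_mem)
qed

text \<open>This separates the arithmetic from the combinatorics: all that the study of
  factorizations needs of the constructed polynomials. \<open>no_fixed_divisor\<close> forbids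
  denominators in products without \<open>F s\<close>, \<open>exact_fixed_divisor\<close> says that
  no maximal ideal contains all values of the product divided by \<open>c\<close>, and
  \<open>divisible_iff\<close> tells which factors may be split off while the rest stays divisible
  by \<open>c\<close>.\<close>

locale factor_blocks = dedekind T for T :: "'a::idom itself" +
  fixes U :: "'i set" and s :: 'i and F :: "'i \<Rightarrow> 'a poly" and c :: 'a
    and S :: "nat \<Rightarrow> 'i set" and n N :: nat
  assumes finite_U: "finite U" and s_notin: "s \<notin> U" and c_nz: "c \<noteq> 0"
    and S_subset: "\<And>k. k \<in> {1..n} \<Longrightarrow> S k \<subseteq> U"
    and S_disjoint: "\<And>k l. k \<in> {1..n} \<Longrightarrow> l \<in> {1..n} \<Longrightarrow> k \<noteq> l \<Longrightarrow> S k \<inter> S l = {}"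
    and S_nonempty: "\<And>k. k \<in> {1..n} \<Longrightarrow> S k \<noteq> {}"
    and N_pos: "N \<ge> 1"
    and F_degree: "\<And>i. i \<in> insert s U \<Longrightarrow> degree (F i) = N"
    and F_monic: "\<And>i. i \<in> insert s U \<Longrightarrow> lead_coeff (F i) = 1"
    and F_irreducible: "\<And>i. i \<in> insert s U \<Longrightarrow> irreducible (map_poly to_fract (F i))"
    and F_inj: "inj_on F (insert s U)"
    and no_fixed_divisor: "\<And>Q. maximal_ideal Q \<Longrightarrow> \<exists>x. \<forall>t\<in>U. poly (F t) x \<notin> Q"
    and exact_fixed_divisor: "\<And>Q. maximal_ideal Q \<Longrightarrow>
      \<exists>x. \<forall>q\<in>Q. poly (F s) x * (\<Prod>t\<in>U. poly (F t) x) \<noteq> c * q"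
    and divisible_iff: "\<And>W. W \<subseteq> U \<Longrightarrow>
      (\<forall>x. c dvd poly (F s) x * (\<Prod>t\<in>U - W. poly (F t) x)) \<longleftrightarrow> (\<exists>k\<in>{1..n}. W \<subseteq> S k)"
begin

section \<open>Prime factors over the quotient field and their constants\<close>

definition G :: "'i \<Rightarrow> 'a fract poly" where "G i = map_poly to_fract (F i)"

abbreviation GP :: "'i set \<Rightarrow> 'a fract poly" where "GP W \<equiv> prod G W"

definition H :: "'a fract poly" where "H = smult (inverse (to_fract c)) (GP (insert s U))"

definition A :: "nat \<Rightarrow> 'a fract poly"
  where "A k = smult (inverse (to_fract c)) (GP (insert s (U - S k)))"

lemma G_prime: "i \<in> insert s U \<Longrightarrow> prime_elem (G i)"
  unfolding G_def using F_irreducible by (intro field_poly_irreducible_imp_prime) auto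

lemma G_degree: "i \<in> insert s U \<Longrightarrow> degree (G i) = N"
  unfolding G_def using F_degree by (simp add: degree_map_poly)

lemma G_monic: "i \<in> insert s U \<Longrightarrow> lead_coeff (G i) = 1"
  unfolding G_def using F_degree F_monic by (simp add: degree_map_poly coeff_map_poly)

lemma G_nz: "i \<in> insert s U \<Longrightarrow> G i \<noteq> 0"
  using G_monic by force

lemma finite_sub: "W \<subseteq> insert s U \<Longrightarrow> finite W"
  using finite_U finite_subset by blast

lemma GP_nz: "W \<subseteq> insert s U \<Longrightarrow> GP W \<noteq> 0"
  using G_nz finite_sub[of W] by auto

lemma GP_degree: "W \<subseteq> insert s U \<Longrightarrow> degree (GP W) = card W * N"
proof -
  assume W: "W \<subseteq> insert s U"
  have "degree (GP W) = (\<Sum>i\<in>W. degree (G i))" using W G_nz by (intro degree_prod_eq_sum_degree) auto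
  also have "\<dots> = (\<Sum>i\<in>W. N)" using W G_degree by (intro sum.cong) auto
  finally show ?thesis by simp
qed

lemma G_assoc_imp_eq:
  assumes "i \<in> insert s U" "j \<in> insert s U" "G i = smult a (G j)"
  shows "i = j"
proof -
  have "lead_coeff (G i) = a * lead_coeff (G j)" unfolding assms(3) by (rule lead_coeff_smult)
  then have "a = 1" using G_monic assms(1,2) by simp
  then have "map_poly to_fract (F i) = map_poly to_fract (F j)" using assms(3) by (simp add: G_def)
  then have "F i = F j" by (simp only: fract_poly_eq_iff)
  then show ?thesis using inj_onD[OF F_inj _ assms(1,2)] by blast
qed

lemma G_dvd_imp_eq:
  assumes ij: "i \<in> insert s U" "j \<in> insert s U" "G i dvd G j"
  shows "i = j"
proof -
  obtain q where q: "G j = G i * q" using assms by (auto simp: dvd_def)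
  have "q \<noteq> 0" using q G_nz[OF ij(2)] by auto
  then have "degree q = 0" using q G_nz[OF ij(1)] G_degree ij(1,2)
    by (metis add_cancel_right_right degree_mult_eq)
  then obtain a where "q = [:a:]" by (metis degree_eq_zeroE)
  then show ?thesis using G_assoc_imp_eq[OF ij(2,1), of a] q by simp
qed

lemma G_dvd_GP_imp_mem:
  assumes W: "W \<subseteq> insert s U" and i: "i \<in> insert s U" "G i dvd smult a (GP W)" and a: "a \<noteq> 0"
  shows "i \<in> W"
proof -
  have "G i dvd GP W" using i(2) a by (simp add: dvd_smult_iff)
  with finite_sub[OF W] have "\<exists>j\<in>W. G i dvd G j"
    by (induction W rule: finite_induct)
      (use G_prime[OF i(1)] in \<open>auto simp: prime_elem_dvd_mult_iff prime_elem_not_unit\<close>)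
  then obtain j where "j \<in> W" "G i dvd G j" by blast
  then show ?thesis using G_dvd_imp_eq[OF i(1), of j] W by blast
qed

text \<open>Unique factorization over the quotient field: each prime \<open>G i\<close> goes into
  \<open>X\<close> or into \<open>Y\<close>, and only the constant is left to be
  distributed.\<close>

lemma split_GP:
  assumes "V \<subseteq> insert s U" "X * Y = smult a (GP V)" "a \<noteq> 0"
  shows "\<exists>W \<alpha> \<beta>. W \<subseteq> V \<and> X = smult \<alpha> (GP W) \<and> Y = smult \<beta> (GP (V - W)) \<and> \<alpha> * \<beta> = a"
  using finite_sub[OF assms(1)] assms
proof (induction V arbitrary: X Y rule: finite_induct)
  case empty
  then have XY: "X * Y = [:a:]" by simp
  then have nz: "X \<noteq> 0" "Y \<noteq> 0" using empty by auto
  have "degree X + degree Y = 0" using XY nz by (metis degree_mult_eq degree_pCons_0)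
  then obtain x y where xy: "X = [:x:]" "Y = [:y:]" by (metis add_is_0 degree_eq_zeroE)
  then have "x * y = a" using XY by (simp add: mult.commute)
  then show ?case using xy by (intro exI[of _ "{}"] exI[of _ x] exI[of _ y]) simp
next
  case (insert i V)
  have i: "i \<in> insert s U" and V: "V \<subseteq> insert s U" using insert.prems(1) by auto
  have GV: "GP (insert i V) = G i * GP V" using insert.hyps by simp
  have "G i dvd X * Y" unfolding insert.prems(2) GV by (simp add: dvd_smult)
  then consider X' where "X = G i * X'" | Y' where "Y = G i * Y'"
    using prime_elem_dvd_mult_iff[OF G_prime[OF i]] by (auto simp: dvd_def)
  then show ?case
  proof cases
    case 1
    have "G i * (X' * Y) = G i * smult a (GP V)" using insert.prems(2) 1 GV by (simp add: ac_simps)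
    then have "X' * Y = smult a (GP V)" using G_nz[OF i] by (simp only: mult_cancel_left) simp
    from insert.IH[OF V this insert.prems(3)] obtain W \<alpha> \<beta> where
      W: "W \<subseteq> V" "X' = smult \<alpha> (GP W)" "Y = smult \<beta> (GP (V - W))" "\<alpha> * \<beta> = a" by blast
    have "i \<notin> W" "insert i V - insert i W = V - W" using W(1) insert.hyps by auto
    moreover have "finite W" using W(1) insert.hyps finite_subset by blast
    ultimately show ?thesis using W 1 by (intro exI[of _ "insert i W"] exI[of _ \<alpha>] exI[of _ \<beta>]) auto
  next
    case 2
    have "G i * (X * Y') = G i * smult a (GP V)" using insert.prems(2) 2 GV by (simp add: ac_simps)
    then have "X * Y' = smult a (GP V)" using G_nz[OF i] by (simp only: mult_cancel_left) simp
    from insert.IH[OF V this insert.prems(3)] obtain W \<alpha> \<beta> where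
      W: "W \<subseteq> V" "X = smult \<alpha> (GP W)" "Y' = smult \<beta> (GP (V - W))" "\<alpha> * \<beta> = a" by blast
    have "insert i V - W = insert i (V - W)" using W(1) insert.hyps by auto
    moreover have "i \<notin> V - W" "finite (V - W)" using insert.hyps by auto
    ultimately show ?thesis using W 2 by (intro exI[of _ W] exI[of _ \<alpha>] exI[of _ \<beta>]) auto
  qed
qed

lemma poly_GP: "poly (GP W) (to_fract x) = to_fract (\<Prod>t\<in>W. poly (F t) x)"
  by (simp add: poly_prod G_def poly_fract_poly to_fract_prod)

lemma GP_IntD: "GP W \<in> IntD"
  unfolding IntD_iff poly_GP by blast

lemma const_unit_smult_IntD:
  assumes "const_unit a" "f \<in> IntD"
  shows "smult a f \<in> IntD"
proof -
  have "[:a:] \<in> IntD" using assms(1) unfolding IntD_iff const_unit_def by auto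
  then show ?thesis using IntD_mult[OF _ assms(2)] by fastforce
qed

text \<open>Write \<open>\<beta>\<close> as \<open>u / v\<close>. Then \<open>v\<close> divides
  \<open>u\<close> times every value of the product, and at each maximal ideal one of these values
  is a local unit, so \<open>v\<close> divides \<open>u\<close> locally everywhere.\<close>

lemma IntD_content:
  assumes W: "W \<subseteq> U" and int: "smult \<beta> (GP W) \<in> IntD"
  shows "\<exists>b. \<beta> = to_fract b"
proof -
  obtain u v where uv: "\<beta> = Fraction_Field.Fract u v" "v \<noteq> 0" by (cases \<beta>) auto
  then have b: "to_fract v * \<beta> = to_fract u" by (simp add: to_fract_def eq_fract)
  have dvd: "v dvd (\<Prod>t\<in>W. poly (F t) x) * u" for x
  proof -
    obtain y where "\<beta> * to_fract (\<Prod>t\<in>W. poly (F t) x) = to_fract y"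
      using int unfolding IntD_iff poly_smult poly_GP by blast
    then have "to_fract v * \<beta> * to_fract (\<Prod>t\<in>W. poly (F t) x) = to_fract v * to_fract y"
      by (simp add: mult.assoc)
    then have "to_fract (u * (\<Prod>t\<in>W. poly (F t) x)) = to_fract (v * y)" unfolding b by simp
    then have "u * (\<Prod>t\<in>W. poly (F t) x) = v * y" by (simp only: to_fract_eq_iff)
    then show ?thesis by (metis dvd_triv_left mult.commute)
  qed
  have "v dvd u"
  proof (rule dvd_local[OF noeth])
    fix Q :: "'a set" assume Q: "maximal_ideal Q"
    obtain x where x: "\<forall>t\<in>U. poly (F t) x \<notin> Q" using no_fixed_divisor[OF Q] by blast
    have "(\<Prod>t\<in>W. poly (F t) x) \<notin> Q" using x W by (intro maximal_prod[OF Q]) auto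
    then show "u \<in> loc Q v" using dvd[of x] by (rule locI)
  qed
  then obtain b where "u = v * b" by (auto simp: dvd_def)
  then have "\<beta> = to_fract b" using uv by (simp add: to_fract_def eq_fract)
  then show ?thesis by blast
qed

text \<open>By \<open>IntD_content\<close>, \<open>\<beta>\<close> comes from a ring element
  \<open>b\<close>. If \<open>b\<close> were not a unit, it would lie in some maximal
  \<open>Q\<close>, and every value of the full product would be \<open>c\<close> times an element
  of \<open>Q\<close>, against \<open>exact_fixed_divisor\<close>.\<close>

lemma cofactor_const_unit:
  assumes W: "W \<subseteq> U" and X: "smult \<alpha> (GP (insert s W)) \<in> IntD" and Y: "smult \<beta> (GP (U - W)) \<in> IntD"
    and ab: "\<alpha> * \<beta> = inverse (to_fract c)"
  shows "const_unit \<beta>"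
proof -
  obtain b where b: "\<beta> = to_fract b" using IntD_content[OF _ Y] by blast
  have "b dvd 1"
  proof (rule ccontr)
    assume nb: "\<not> b dvd 1"
    have "is_ideal {x. b dvd x}" by (auto simp: is_ideal_def dvd_add)
    moreover have "{x. b dvd x} \<noteq> UNIV" using nb by blast
    ultimately obtain Q where Q: "maximal_ideal Q" "{x. b dvd x} \<subseteq> Q"
      using exists_maximal_ideal[OF noeth, of "{x. b dvd x}"] by blast
    have I: "is_ideal Q" using Q(1) by (rule maximal_ideal_ideal)
    have bQ: "b \<in> Q" using Q(2) by auto
    obtain x where x: "\<forall>q\<in>Q. poly (F s) x * (\<Prod>t\<in>U. poly (F t) x) \<noteq> c * q"
      using exact_fixed_divisor[OF Q(1)] by blast
    define V where "V = (\<Prod>t\<in>U - W. poly (F t) x)"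
    obtain y where y: "\<alpha> * to_fract (\<Prod>t\<in>insert s W. poly (F t) x) = to_fract y"
      using X unfolding IntD_iff poly_smult poly_GP by blast
    have s: "s \<notin> W" and fW: "finite W" using s_notin W finite_U finite_subset by blast+
    have "poly (F s) x * (\<Prod>t\<in>U. poly (F t) x) = (\<Prod>t\<in>insert s W. poly (F t) x) * V"
      unfolding V_def using s fW prod.subset_diff[OF W finite_U, of "\<lambda>t. poly (F t) x"]
        by (simp add: ac_simps)
    moreover have "to_fract ((\<Prod>t\<in>insert s W. poly (F t) x) * V) = to_fract (c * (b * (y * V)))"
    proof -
      have "to_fract c * \<beta> * \<alpha> = to_fract c * (\<alpha> * \<beta>)" by (simp add: ac_simps)
      also have "\<dots> = 1" unfolding ab using c_nz by simp
      finally have "to_fract (\<Prod>t\<in>insert s W. poly (F t) x) =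
        to_fract c * \<beta> * (\<alpha> * to_fract (\<Prod>t\<in>insert s W. poly (F t) x))"
        by (simp flip: mult.assoc)
      then show ?thesis unfolding y b by simp
    qed
    ultimately have "poly (F s) x * (\<Prod>t\<in>U. poly (F t) x) = c * (b * (y * V))"
      by (simp only: to_fract_eq_iff)
    then show False using x ideal_mult_right[OF I bQ] by blast
  qed
  then obtain a where "b * a = 1" by (metis dvdE)
  then show ?thesis unfolding const_unit_def b by blast
qed

lemma IntD_over_c_iff:
  assumes W: "W \<subseteq> U"
  shows "smult (inverse (to_fract c)) (GP (insert s (U - W))) \<in> IntD \<longleftrightarrow> (\<exists>k\<in>{1..n}. W \<subseteq> S k)"
proof -
  have fin: "finite (U - W)" and s: "s \<notin> U - W" using finite_U s_notin by auto
  have "(\<exists>y. inverse (to_fract c) * to_fract w = to_fract y) \<longleftrightarrow> c dvd w" for w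
  proof -
    have "inverse (to_fract c) * to_fract w = to_fract y \<longleftrightarrow> to_fract w = to_fract (c * y)" for y
      using c_nz by (auto simp: field_simps)
    then show ?thesis unfolding to_fract_eq_iff dvd_def by simp
  qed
  then show ?thesis
    unfolding IntD_iff poly_smult poly_GP divisible_iff[OF W, symmetric]
    by (simp only: prod.insert[OF fin s])
qed

lemma A_IntD: "k \<in> {1..n} \<Longrightarrow> A k \<in> IntD"
  unfolding A_def using IntD_over_c_iff[OF S_subset] by blast

lemma irreducible_GP_card:
  assumes W: "W \<subseteq> U" and b: "const_unit \<beta>" and irr: "irreducible_in IntD (smult \<beta> (GP W))"
  shows "\<exists>t. W = {t}"
proof -
  have fin: "finite W" using W finite_U finite_subset by blast
  have W': "W \<subseteq> insert s U" using W by blast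
  have "W \<noteq> {}"
  proof
    assume "W = {}"
    then have "unit_in IntD (smult \<beta> (GP W))" using b unfolding unit_in_IntD_iff by auto
    then show False using irr by (simp add: irreducible_in_def)
  qed
  then obtain t where t: "t \<in> W" by blast
  have "smult \<beta> (GP W) = smult \<beta> (G t) * GP (W - {t})" using fin t by (simp add: prod.remove)
  moreover have "smult \<beta> (G t) \<in> IntD" using const_unit_smult_IntD[OF b GP_IntD, of "{t}"] by simp
  ultimately have "unit_in IntD (smult \<beta> (G t)) \<or> unit_in IntD (GP (W - {t}))"
    using irr GP_IntD unfolding irreducible_in_def by blast
  moreover have "degree (smult \<beta> (G t)) = N" using const_unit_nonzero[OF b] G_degree t W' by auto
  ultimately have "degree (GP (W - {t})) = 0" using N_pos unit_in_IntD_degree by force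
  then have "card (W - {t}) = 0" using GP_degree[of "W - {t}"] W' N_pos by auto
  then have "W - {t} = {}" using fin by simp
  then show ?thesis using t by blast
qed

text \<open>Over the quotient field only constants split off; by \<open>IntD_content\<close> both
  constants come from the ring, and as their product is 1 they are units.\<close>

lemma G_irreducible_in:
  assumes t: "t \<in> U"
  shows "irreducible_in IntD (G t)"
proof -
  have tU: "{t} \<subseteq> insert s U" using t by blast
  have G: "G t \<in> IntD" using GP_IntD[of "{t}"] by simp
  have "unit_in IntD X \<or> unit_in IntD Y" if XY: "X \<in> IntD" "Y \<in> IntD" "G t = X * Y" for X Y
  proof -
    have "X * Y = smult 1 (GP {t})" using XY(3) by simp
    from split_GP[OF tU this] obtain W \<alpha> \<beta> where W: "W \<subseteq> {t}" "X = smult \<alpha> (GP W)"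
      "Y = smult \<beta> (GP ({t} - W))" "\<alpha> * \<beta> = 1" by auto
    have "W \<subseteq> U" "{t} - W \<subseteq> U" using W(1) t by auto
    then obtain a b where ab: "\<alpha> = to_fract a" "\<beta> = to_fract b"
      using IntD_content XY(1,2) W(2,3) by metis
    have u: "const_unit \<alpha>" "const_unit \<beta>"
      using const_unit_factor[of a b] const_unit_factor[of b a] W(4) ab const_unit_1
        by (simp_all add: mult.commute)
    consider "W = {}" | "W = {t}" using W(1) by blast
    then show ?thesis using u W(2,3) unfolding unit_in_IntD_iff by cases auto
  qed
  moreover have "\<not> unit_in IntD (G t)"
    using unit_in_IntD_degree[of "G t"] G_degree[of t] t N_pos by auto
  ultimately show ?thesis unfolding irreducible_in_def using G G_nz[of t] t by blast
qed

text \<open>The side containing \<open>G s\<close> must carry the whole denominator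
  \<open>c\<close>, since the constant of the other side is a unit. That it stays integer-valued
  without the factors of \<open>W\<close> then forces \<open>W\<close> into a single block.\<close>

lemma split_H:
  assumes "X \<in> IntD" "Y \<in> IntD" "X * Y = H" "G s dvd X"
  shows "\<exists>W \<beta>. W \<subseteq> U \<and> const_unit \<beta> \<and> Y = smult \<beta> (GP W) \<and>
    X = smult (inverse \<beta>) (smult (inverse (to_fract c)) (GP (insert s (U - W)))) \<and>
      (\<exists>k\<in>{1..n}. W \<subseteq> S k)"
proof -
  have c0: "inverse (to_fract c) \<noteq> 0" using c_nz by simp
  obtain V \<alpha> \<beta> where V: "V \<subseteq> insert s U" "X = smult \<alpha> (GP V)" "Y = smult \<beta> (GP (insert s U - V))"
    "\<alpha> * \<beta> = inverse (to_fract c)"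
    using split_GP[OF subset_refl assms(3)[unfolded H_def] c0] by blast
  have nz: "\<alpha> \<noteq> 0" "\<beta> \<noteq> 0" using V(4) c0 by auto
  have "s \<in> V" using G_dvd_GP_imp_mem[OF V(1) _ assms(4)[unfolded V(2)] nz(1)] by blast
  define W where "W = insert s U - V"
  have W: "W \<subseteq> U" "V = insert s (U - W)" "U - (U - W) = W"
    using V(1) \<open>s \<in> V\<close> s_notin unfolding W_def by auto
  have Y: "Y = smult \<beta> (GP W)" using V(3) W_def by simp
  have u: "const_unit \<beta>"
    by (rule cofactor_const_unit[of "U - W" \<alpha>]) (use assms(1,2) V W Y in auto)
  have \<alpha>: "\<alpha> = inverse \<beta> * inverse (to_fract c)" using nz(2) unfolding V(4)[symmetric] by simp
  then have X: "X = smult (inverse \<beta>) (smult (inverse (to_fract c)) (GP (insert s (U - W))))"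
    using V(2) W(2) by simp
  have "smult \<beta> X = smult (inverse (to_fract c)) (GP (insert s (U - W)))" using nz(2) unfolding X
    by (simp flip: mult.assoc)
  then have "smult (inverse (to_fract c)) (GP (insert s (U - W))) \<in> IntD"
    using const_unit_smult_IntD[OF u assms(1)] by simp
  then show ?thesis using IntD_over_c_iff[OF W(1)] W(1) u X Y by blast
qed

lemma H_eq:
  assumes "W \<subseteq> U"
  shows "smult (inverse (to_fract c)) (GP (insert s (U - W))) * GP W = H"
proof -
  have "insert s U = insert s (U - W) \<union> W" "insert s (U - W) \<inter> W = {}" using assms s_notin by auto
  moreover have "finite W" using assms finite_U finite_subset by blast
  ultimately have "GP (insert s U) = GP (insert s (U - W)) * GP W"
    using finite_U by (metis finite_Diff finite_insert prod.union_disjoint)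
  then show ?thesis by (simp add: H_def)
qed

lemma A_degree: "k \<in> {1..n} \<Longrightarrow> degree (A k) = (1 + card (U - S k)) * N"
proof -
  have "degree (A k) = degree (GP (insert s (U - S k)))" unfolding A_def using c_nz by simp
  also have "\<dots> = card (insert s (U - S k)) * N" by (rule GP_degree) auto
  also have "card (insert s (U - S k)) = 1 + card (U - S k)" using finite_U s_notin by simp
  finally show ?thesis .
qed

text \<open>Let \<open>A k = X * Y\<close> with \<open>G s dvd X\<close>. Multiplying
  \<open>Y\<close> by \<open>GP (S k)\<close> gives a splitting of \<open>H\<close> whose cofactor
  set \<open>W\<close> contains \<open>S k\<close> and lies in one block. As the blocks are disjoint
  and nonempty, \<open>W = S k\<close>, so \<open>Y\<close> is a unit.\<close>

lemma A_irreducible_in: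
  assumes k: "k \<in> {1..n}"
  shows "irreducible_in IntD (A k)"
proof -
  have half: "unit_in IntD Y" if XY: "X \<in> IntD" "Y \<in> IntD" "A k = X * Y" "G s dvd X" for X Y
  proof -
    have "X * (Y * GP (S k)) = H"
      using H_eq[OF S_subset[OF k]] unfolding A_def[symmetric] XY(3) by (simp only: mult.assoc)
    from split_H[OF XY(1) IntD_mult[OF XY(2) GP_IntD] this XY(4)] obtain W \<beta> l where
      W: "W \<subseteq> U" "const_unit \<beta>" "Y * GP (S k) = smult \<beta> (GP W)" "l \<in> {1..n}" "W \<subseteq> S l" by blast
    have \<beta>: "\<beta> \<noteq> 0" using const_unit_nonzero[OF W(2)] .
    have W': "W \<subseteq> insert s U" using W(1) by blast
    have "S k \<subseteq> W"
    proof
      fix t assume t: "t \<in> S k"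
      have "finite (S k)" using S_subset[OF k] finite_U finite_subset by blast
      then have "G t dvd smult \<beta> (GP W)"
        unfolding W(3)[symmetric] using t by (intro dvd_mult dvd_prodI)
      then show "t \<in> W" using G_dvd_GP_imp_mem[OF W' _ _ \<beta>] t S_subset[OF k] by blast
    qed
    then have "l = k" using S_disjoint[OF W(4) k] S_nonempty[OF k] W(5) by blast
    then have "W = S k" using W(5) \<open>S k \<subseteq> W\<close> by blast
    then have "GP (S k) * Y = GP (S k) * [:\<beta>:]" using W(3) by (simp add: mult.commute)
    then have "Y = [:\<beta>:]" using GP_nz[of "S k"] S_subset[OF k] by (simp only: mult_cancel_left) auto
    then show ?thesis using W(2) unfolding unit_in_IntD_iff by blast
  qed
  have "G s dvd A k" unfolding A_def using finite_U by (intro dvd_smult dvd_prodI) auto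
  have "unit_in IntD X \<or> unit_in IntD Y" if XY: "X \<in> IntD" "Y \<in> IntD" "A k = X * Y" for X Y
  proof -
    have "G s dvd X \<or> G s dvd Y"
      using \<open>G s dvd A k\<close> G_prime[of s] XY(3) by (simp add: prime_elem_dvd_mult_iff)
    then show ?thesis using half[of X Y] half[of Y X] XY by (auto simp: mult.commute)
  qed
  moreover have "degree (A k) > 0" using A_degree[OF k] N_pos by simp
  moreover from this have "A k \<noteq> 0" by auto
  ultimately show ?thesis unfolding irreducible_in_def
    using A_IntD[OF k] unit_in_IntD_degree[of "A k"] by auto
qed

text \<open>Without \<open>G s\<close> factorization is unique: all constants are units, so each
  irreducible factor is a single \<open>G t\<close> up to a unit.\<close>

lemma GP_factorization:
  assumes "W \<subseteq> U" "const_unit \<beta>" "\<And>g. g \<in> set gs \<Longrightarrow> irreducible_in IntD g"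
    "prod_list gs = smult \<beta> (GP W)"
  shows "\<exists>ts u. distinct ts \<and> set ts = W \<and> gs = map (\<lambda>t. smult (u t) (G t)) ts \<and>
    (\<forall>t\<in>W. const_unit (u t))"
  using assms
proof (induction gs arbitrary: W \<beta>)
  case Nil
  have "degree (smult \<beta> (GP W)) = 0" using Nil.prems(4) by (metis degree_1 prod_list.Nil)
  then have "card W * N = 0" using GP_degree[of W] Nil.prems(1) const_unit_nonzero[OF Nil.prems(2)]
    by auto
  moreover have "finite W" using Nil.prems(1) finite_U by (rule finite_subset)
  ultimately have "W = {}" using N_pos by simp
  then show ?case by auto
next
  case (Cons g gs)
  have W': "W \<subseteq> insert s U" using Cons.prems(1) by blast
  have "g * prod_list gs = smult \<beta> (GP W)" using Cons.prems(4) by simp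
  from split_GP[OF W' this const_unit_nonzero[OF Cons.prems(2)]] obtain V \<alpha> \<gamma> where
    V: "V \<subseteq> W" "g = smult \<alpha> (GP V)" "prod_list gs = smult \<gamma> (GP (W - V))" "\<alpha> * \<gamma> = \<beta>" by blast
  have int: "g \<in> IntD" "prod_list gs \<in> IntD"
    using Cons.prems(3) by (auto simp: irreducible_in_def intro: IntD_prod_list)
  have VU: "V \<subseteq> U" "W - V \<subseteq> U" using V(1) Cons.prems(1) by auto
  then obtain a b where ab: "\<alpha> = to_fract a" "\<gamma> = to_fract b" using IntD_content int V(2,3) by metis
  have u: "const_unit \<alpha>" "const_unit \<gamma>"
    using const_unit_factor[of a b] const_unit_factor[of b a] V(4) ab Cons.prems(2)
      by (simp_all add: mult.commute)
  have "irreducible_in IntD (smult \<alpha> (GP V))" using Cons.prems(3) V(2) by simp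
  from irreducible_GP_card[OF VU(1) u(1) this] obtain t where t: "V = {t}" by blast
  from Cons.IH[OF VU(2) u(2) _ V(3)] Cons.prems(3) obtain ts v where
    ts: "distinct ts" "set ts = W - {t}" "gs = map (\<lambda>t. smult (v t) (G t)) ts"
      "\<forall>x\<in>W - {t}. const_unit (v x)"
    unfolding t by auto
  have "g # gs = map (\<lambda>x. smult ((v(t := \<alpha>)) x) (G x)) (t # ts)" using V(2) t ts(2,3) by auto
  moreover have "distinct (t # ts)" "set (t # ts) = W" using ts(1,2) V(1) t by auto
  moreover have "\<forall>x\<in>W. const_unit ((v(t := \<alpha>)) x)" using ts(4) u(1) by auto
  ultimately show ?case by (intro exI[of _ "t # ts"] exI[of _ "v(t := \<alpha>)"] conjI)
qed

section \<open>The \<open>n\<close> factorizations of \<open>H\<close>\<close>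

definition fact_list :: "nat \<Rightarrow> 'a fract poly list" where
  "fact_list k = A k # map G (SOME ts. distinct ts \<and> set ts = S k)"

lemma fact_list:
  assumes "k \<in> {1..n}"
  obtains ts where "distinct ts" "set ts = S k" "fact_list k = A k # map G ts"
proof -
  have "finite (S k)" using S_subset[OF assms] finite_U finite_subset by blast
  then have "\<exists>ts. distinct ts \<and> set ts = S k" using finite_distinct_list by metis
  from someI_ex[OF this] show ?thesis using that unfolding fact_list_def by blast
qed

lemma fact_list_length:
  assumes "k \<in> {1..n}"
  shows "length (fact_list k) = card (S k) + 1"
proof -
  obtain ts where ts: "distinct ts" "set ts = S k" "fact_list k = A k # map G ts"
    using fact_list[OF assms] .
  then show ?thesis using distinct_card[OF ts(1)] by simp
qed

lemma fact_list_factorization: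
  assumes k: "k \<in> {1..n}"
  shows "factorization_in IntD H (fact_list k)"
proof -
  obtain ts where ts: "distinct ts" "set ts = S k" "fact_list k = A k # map G ts"
    using fact_list[OF k] .
  have "prod_list (map G ts) = GP (S k)"
    using ts(1,2) prod.distinct_set_conv_list[OF ts(1), of G] by simp
  then have "prod_list (fact_list k) = H" using ts(3) H_eq[OF S_subset[OF k]] by (simp add: A_def)
  moreover have "\<forall>a\<in>set (fact_list k). irreducible_in IntD a"
    using ts(2,3) A_irreducible_in[OF k] G_irreducible_in S_subset[OF k] by auto
  ultimately show ?thesis using ts(3) unfolding factorization_in_def by simp
qed

text \<open>Any \<open>G t\<close> with \<open>t \<in> S k\<close> tells the two apart:
  \<open>t\<close> is not in \<open>S l\<close>, and \<open>A l\<close> has larger degree than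
  \<open>G t\<close> because it retains both \<open>G s\<close> and \<open>G t\<close>.\<close>

lemma fact_list_not_ess_same:
  assumes k: "k \<in> {1..n}" and l: "l \<in> {1..n}" and "k \<noteq> l"
  shows "\<not> ess_same_in IntD (fact_list k) (fact_list l)"
proof
  assume ess: "ess_same_in IntD (fact_list k) (fact_list l)"
  obtain ts where ts: "set ts = S k" "fact_list k = A k # map G ts" using fact_list[OF k] by metis
  obtain ts' where ts': "set ts' = S l" "fact_list l = A l # map G ts'"
    using fact_list[OF l] by metis
  obtain t where t: "t \<in> S k" using S_nonempty[OF k] by blast
  then have tU: "t \<in> insert s U" "t \<in> U - S l"
    using S_subset[OF k] S_disjoint[OF k l \<open>k \<noteq> l\<close>] by auto
  have "G t \<in> set (fact_list k)" using t ts by simp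
  then obtain g u where g: "g \<in> set (fact_list l)" "unit_in IntD u" "G t = u * g"
    using ess_same_in_member[OF ess] by blast
  obtain a where a: "u = [:a:]" "a \<noteq> 0"
    using g(2) const_unit_nonzero unfolding unit_in_IntD_iff by blast
  have Gt: "G t = smult a g" using g(3) a by simp
  consider "g = A l" | t' where "t' \<in> S l" "g = G t'" using g(1) ts' by auto
  then show False
  proof cases
    case 1
    then have "N = (1 + card (U - S l)) * N" using Gt a(2) G_degree[OF tU(1)] A_degree[OF l] by simp
    moreover have "card (U - S l) \<noteq> 0" using tU(2) finite_U by auto
    ultimately show False using N_pos by simp
  next
    case 2
    then have "t' \<in> insert s U" using S_subset[OF l] by blast
    then have "t = t'" using G_assoc_imp_eq[OF tU(1)] Gt 2 by blast
    then show False using tU(2) 2 by blast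
  qed
qed

lemma fact_list_complete:
  assumes fs: "factorization_in IntD H fs"
  shows "\<exists>k\<in>{1..n}. ess_same_in IntD fs (fact_list k)"
proof -
  have irr: "\<And>f. f \<in> set fs \<Longrightarrow> irreducible_in IntD f" and prod: "prod_list fs = H"
    using fs by (auto simp: factorization_in_def)
  have "G s dvd H" unfolding H_def using finite_U by (intro dvd_smult dvd_prodI) auto
  then have "\<exists>X\<in>set fs. G s dvd X"
    unfolding prod[symmetric] using G_prime[of s]
    by (induction fs) (auto simp: prime_elem_dvd_mult_iff prime_elem_not_unit)
  then obtain X xs ys where X: "fs = xs @ X # ys" "G s dvd X" by (metis split_list)
  have XH: "X * prod_list (xs @ ys) = H" using prod X(1) by (simp add: ac_simps)
  have irrX: "irreducible_in IntD X" using irr X(1) by auto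
  have irrY: "irreducible_in IntD g" if "g \<in> set (xs @ ys)" for g using irr X(1) that by auto
  have "X \<in> IntD" "prod_list (xs @ ys) \<in> IntD"
    using irrX irrY by (auto simp: irreducible_in_def intro!: IntD_prod_list simp del: prod_list.append)
  from split_H[OF this XH X(2)] obtain W \<beta> k where W: "W \<subseteq> U" "const_unit \<beta>"
    "prod_list (xs @ ys) = smult \<beta> (GP W)"
    "X = smult (inverse \<beta>) (smult (inverse (to_fract c)) (GP (insert s (U - W))))" "k \<in> {1..n}"
      "W \<subseteq> S k" by blast
  have \<beta>: "\<beta> \<noteq> 0" using const_unit_nonzero[OF W(2)] .
  \<comment> \<open>If some \<open>t \<in> S k\<close> were missing from \<open>W\<close>, then
    \<open>G t\<close> could be split off from \<open>X\<close>: the rest stays integer-valued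
    because \<open>insert t W\<close> is still inside \<open>S k\<close>. Both parts have positive
    degree, so \<open>X\<close> would be reducible.\<close>
  have "W = S k"
  proof (rule ccontr)
    assume "W \<noteq> S k"
    then obtain t where t: "t \<in> S k" "t \<notin> W" using W(6) by blast
    have tU: "t \<in> U" using t(1) S_subset[OF W(5)] by blast
    define Z where "Z = smult (inverse (to_fract c)) (GP (insert s (U - insert t W)))"
    have "Z \<in> IntD" unfolding Z_def using IntD_over_c_iff[of "insert t W"] W(1,5,6) t tU by blast
    then have Z: "smult (inverse \<beta>) Z \<in> IntD"
      using const_unit_smult_IntD const_unit_inverse W(2) by blast
    have "insert s (U - W) = insert t (insert s (U - insert t W))" "t \<notin> insert s (U - insert t W)"
      using t tU s_notin by auto
    then have "GP (insert s (U - W)) = G t * GP (insert s (U - insert t W))"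
      using finite_U by (metis finite_Diff finite_insert prod.insert)
    then have "X = smult (inverse \<beta>) Z * G t" unfolding W(4) Z_def by (simp add: mult.commute)
    then have "unit_in IntD (smult (inverse \<beta>) Z) \<or> unit_in IntD (G t)"
      using irrX Z GP_IntD[of "{t}"] unfolding irreducible_in_def by auto
    moreover have "degree (G t) > 0" using G_degree[of t] tU N_pos by simp
    moreover have "degree (smult (inverse \<beta>) Z) > 0"
    proof -
      have "degree (smult (inverse \<beta>) Z) = card (insert s (U - insert t W)) * N"
        unfolding Z_def using \<beta> c_nz GP_degree[of "insert s (U - insert t W)"] by auto
      moreover have "card (insert s (U - insert t W)) \<noteq> 0" using finite_U by simp
      ultimately show ?thesis using N_pos by (simp only: nat_0_less_mult_iff neq0_conv) simp
    qed
    ultimately show False using unit_in_IntD_degree by fastforce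
  qed
  then have XA: "X = smult (inverse \<beta>) (A k)" using W(4) by (simp add: A_def)
  obtain ts u where ts: "distinct ts" "set ts = S k" "xs @ ys = map (\<lambda>t. smult (u t) (G t)) ts"
    "\<And>t. t \<in> S k \<Longrightarrow> const_unit (u t)"
    using GP_factorization[OF W(1,2) irrY W(3)] \<open>W = S k\<close> by metis
  obtain ts' where ts': "distinct ts'" "set ts' = S k" "fact_list k = A k # map G ts'"
    using fact_list[OF W(5)] .
  \<comment> \<open>The factors of \<open>fs\<close> rearranged into the order of
    \<open>fact_list k\<close>, so that corresponding entries differ by units.\<close>
  define gs where "gs = X # map (\<lambda>t. smult (u t) (G t)) ts'"
  have "mset ts = mset ts'" using set_eq_iff_mset_eq_distinct[OF ts(1) ts'(1)] ts(2) ts'(2) by simp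
  then have "mset (xs @ ys) = mset (map (\<lambda>t. smult (u t) (G t)) ts')" unfolding ts(3) by simp
  then have perm: "fs <~~> gs" unfolding X(1) gs_def by simp
  have "ess_same_in IntD fs (fact_list k)"
  proof (rule ess_same_in_permI[OF perm])
    show "length (fact_list k) = length gs" unfolding ts'(3) gs_def by simp
    fix j assume j: "j < length gs"
    show "\<exists>v. unit_in IntD v \<and> gs ! j = v * fact_list k ! j"
    proof (cases j)
      case 0
      then show ?thesis unfolding gs_def ts'(3) XA
        using const_unit_inverse[OF W(2)]
          by (intro exI[of _ "[:inverse \<beta>:]"]) (auto simp: unit_in_IntD_iff)
    next
      case (Suc i)
      then have i: "i < length ts'" using j by (simp add: gs_def)
      then have "const_unit (u (ts' ! i))" using ts(4) ts'(2) nth_mem by blast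
      then show ?thesis unfolding gs_def ts'(3)
        using Suc i by (intro exI[of _ "[:u (ts' ! i):]"]) (auto simp: unit_in_IntD_iff)
    qed
  qed
  then show ?thesis using W(5) by blast
qed

lemma H_IntD:
  assumes "n \<ge> 1"
  shows "H \<in> IntD"
proof -
  have "1 \<in> {1..n}" using assms by simp
  then show ?thesis using H_eq[OF S_subset] A_IntD IntD_mult[OF _ GP_IntD] unfolding A_def by metis
qed

end

section \<open>Construction of the polynomial\<close>

text \<open>Padding to a common degree by a power of the variable keeps the local conditions at
  every point outside the maximal ideal in question.\<close>

lemma monic_pad:
  fixes h :: "'a::idom poly"
  assumes "lead_coeff h = 1" "degree h \<le> N"
  shows "degree (h * monom 1 (N - degree h)) = N" "lead_coeff (h * monom 1 (N - degree h)) = 1"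
proof -
  have "h \<noteq> 0" using assms(1) by auto
  then show "degree (h * monom 1 (N - degree h)) = N"
    using assms by (simp add: degree_mult_eq degree_monom_eq)
  show "lead_coeff (h * monom 1 (N - degree h)) = 1"
    unfolding lead_coeff_mult using assms by (simp add: degree_monom_eq)
qed

text \<open>With \<open>y\<close> the product of all differences, the elements of \<open>E\<close>
  stay incongruent modulo every maximal ideal that avoids \<open>y\<close>, that is, modulo all but
  finitely many in a Dedekind domain that is not a field.\<close>

lemma separating_element:
  fixes E :: "'a::idom set"
  assumes "finite E"
  shows "\<exists>y. y \<noteq> 0 \<and> (\<forall>Q a b. maximal_ideal Q \<longrightarrow> y \<notin> Q \<longrightarrow> a \<in> E \<longrightarrow> b \<in> E \<longrightarrow> a \<noteq> b \<longrightarrow> a - b \<notin> Q)"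
proof -
  define X where "X = {ab \<in> E \<times> E. fst ab \<noteq> snd ab}"
  have X: "finite X" using assms by (simp add: X_def)
  define y where "y = (\<Prod>ab\<in>X. fst ab - snd ab)"
  have "y \<noteq> 0" using X by (simp add: y_def X_def)
  moreover have "a - b \<notin> Q" if "maximal_ideal Q" "y \<notin> Q" "a \<in> E" "b \<in> E" "a \<noteq> b" for Q a b
  proof
    assume "a - b \<in> Q"
    then have "y \<in> Q"
      unfolding y_def using that
        by (intro ideal_prod[OF maximal_ideal_ideal X, of Q "(a, b)"]) (auto simp: X_def)
    then show False using that by blast
  qed
  ultimately show ?thesis by blast
qed

section \<open>Choice of \<open>P\<close>, the local targets and the polynomials\<close>

context dedekind
begin

text \<open>The case of an empty \<open>B\<close>, transferred from \<open>p ^ e\<close> to the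
  locally associated \<open>c\<close>.\<close>

lemma fixed_divisor_target:
  assumes Q: "maximal_ideal (Q :: 'a set)" and fin: "finite (residue_classes Q)" and c: "c \<noteq> 0"
  shows "\<exists>h. lead_coeff h = 1 \<and> (\<forall>x. poly h x \<in> loc Q c) \<and> (\<exists>x. x - 1 \<in> Q \<and>
    locassoc Q c (poly h x))"
proof -
  obtain p t where p: "p \<in> Q" "t \<notin> Q" "p \<noteq> 0" "\<forall>y\<in>Q. p dvd t * y" using uniformizer[OF Q] by blast
  obtain e where e: "locassoc Q c (p ^ e)" using locassoc_power[OF Q p c] by blast
  obtain h where h: "lead_coeff h = 1" "\<forall>x. poly h x \<in> loc Q (p ^ e)"
    "\<exists>x. x - 1 \<in> Q \<and> locassoc Q (p ^ e) (poly h x)"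
    using local_fixed_divisor_poly[OF Q fin p(1,2,4), of "{}" e] by auto
  then show ?thesis using locassoc_subset[OF Q e] locassoc_trans[OF Q e] by blast
qed

lemma factor_blocks_exist:
  fixes n :: nat and m :: "nat \<Rightarrow> nat"
  assumes inf_max: "infinite {P::'a set. maximal_ideal P}"
    and fin_idx: "\<And>P::'a set. maximal_ideal P \<Longrightarrow> finite (residue_classes P)"
    and n: "n \<ge> 1" and m: "\<And>k. k \<in> {1..n} \<Longrightarrow> 1 \<le> m k"
  shows "\<exists>F (c::'a) N. factor_blocks T (SIGMA k:{1..n}. {..<m k}) (0, 0) F c (\<lambda>k. {k} \<times> {..<m k}) n N"
proof -
  have inf: "infinite (UNIV :: 'a set)"
  proof
    assume "finite (UNIV :: 'a set)"
    then have "finite (UNIV :: 'a set set)" by (simp add: Finite_Set.finite_set)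
    then show False using inf_max finite_subset[OF subset_UNIV] by blast
  qed
  define U where "U = (SIGMA k:{1..n}. {..<m k})"
  define s :: "nat \<times> nat" where "s = (0, 0)"
  define S where "S k = {k} \<times> {..<m k}" for k
  have U: "finite U" "s \<notin> U" by (auto simp: U_def s_def)
  define Pr where "Pr = {tu \<in> U \<times> U. fst (fst tu) \<noteq> fst (snd tu)}"
  have Pr: "finite Pr" using U(1) by (simp add: Pr_def)
  have "infinite (UNIV - {0, 1 :: 'a})" using inf by (simp add: Diff_infinite_finite)
  then obtain \<rho> where \<rho>: "inj_on \<rho> Pr" "\<rho> ` Pr \<subseteq> UNIV - {0, 1 :: 'a}"
    using finite_inj_into_infinite[OF Pr] by blast
  obtain y where y: "y \<noteq> 0" "\<And>Q a b. maximal_ideal Q \<Longrightarrow> y \<notin> Q \<Longrightarrow> a \<in> {0, 1} \<union> \<rho> ` Pr \<Longrightarrow>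
    b \<in> {0, 1} \<union> \<rho> ` Pr \<Longrightarrow>
      a \<noteq> b \<Longrightarrow> a - b \<notin> Q"
    using separating_element[OF finite_UnI[OF _ finite_imageI[OF Pr]], of "{0, 1}" \<rho>] by blast
  have "infinite ({P. maximal_ideal P} - {Q. maximal_ideal Q \<and> y \<in> Q})"
    using finite_maximal_containing[OF y(1)] inf_max by (rule Diff_infinite_finite)
  then obtain P where P: "maximal_ideal P" "y \<notin> P"
    by (metis (no_types, lifting) DiffE finite.emptyI mem_Collect_eq equals0I)
  have PI: "is_ideal P" using P(1) by (rule maximal_ideal_ideal)
  have \<rho>P: "\<rho> p \<notin> P" "1 - \<rho> p \<notin> P" if "p \<in> Pr" for p
    using y(2)[OF P, of "\<rho> p" 0] y(2)[OF P, of 1 "\<rho> p"] \<rho>(2) that by auto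
  have \<rho>PP: "\<rho> p - \<rho> p' \<notin> P" if "p \<in> Pr" "p' \<in> Pr" "p \<noteq> p'" for p p'
    using y(2)[OF P, of "\<rho> p" "\<rho> p'"] inj_onD[OF \<rho>(1)] that by blast
  obtain c t0 where c: "c \<in> P" "t0 \<notin> P" "c \<noteq> 0" "\<forall>y\<in>P. c dvd t0 * y"
    using uniformizer[OF P(1)] by blast
  have PlocP: "P \<subseteq> loc P c" using c(2,4) locI[of t0 P c] by blast
  define B where "B Q = (if Q = P then \<rho> ` Pr else {})" for Q
  have "\<exists>h. lead_coeff h = 1 \<and> (\<forall>x. (\<forall>b\<in>B Q. x - b \<notin> Q) \<longrightarrow> poly h x \<in> loc Q c) \<and>
    (\<forall>x. \<forall>b\<in>B Q. x - b \<in> Q \<longrightarrow> poly h x \<notin> Q) \<and> (\<exists>x. x - 1 \<in> Q \<and> locassoc Q c (poly h x))"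
    if Q: "maximal_ideal Q" for Q
  proof (cases "Q = P")
    case True
    have "1 - b \<notin> P" if "b \<in> \<rho> ` Pr" for b using \<rho>P(2) that by blast
    from local_fixed_divisor_poly[OF P(1) fin_idx[OF P(1)] c(1,2,4) this, where e = 1 and B =
      "\<rho> ` Pr"]
    show ?thesis unfolding B_def True by simp
  next
    case False
    then show ?thesis using fixed_divisor_target[OF Q fin_idx[OF Q] c(3)] by (simp add: B_def)
  qed
  then obtain hs where hs: "\<And>Q. maximal_ideal Q \<Longrightarrow> lead_coeff (hs Q) = 1"
    "\<And>Q x. maximal_ideal Q \<Longrightarrow> \<forall>b\<in>B Q. x - b \<notin> Q \<Longrightarrow> poly (hs Q) x \<in> loc Q c"
    "\<And>Q x b. maximal_ideal Q \<Longrightarrow> b \<in> B Q \<Longrightarrow> x - b \<in> Q \<Longrightarrow> poly (hs Q) x \<notin> Q"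
    "\<And>Q. maximal_ideal Q \<Longrightarrow> \<exists>x. x - 1 \<in> Q \<and> locassoc Q c (poly (hs Q) x)" by metis
  define \<C> where "\<C> = {Q. maximal_ideal Q \<and> c \<in> Q}"
  have fC: "finite \<C>" unfolding \<C>_def by (rule finite_maximal_containing[OF c(3)])
  define N where "N = 1 + (\<Sum>Q\<in>\<C>. degree (hs Q)) + card Pr"
  have hsN: "degree (hs Q) \<le> N" if "maximal_ideal Q" "c \<in> Q" for Q
    using member_le_sum[OF _ _ fC, of Q "\<lambda>Q. degree (hs Q)"] that by (simp add: N_def \<C>_def)
  define I where "I = insert s U"
  have I: "finite I" using U by (simp add: I_def)
  obtain E :: "'a set" where "finite E \<and> card E = card I * N + 1 \<and> E \<subseteq> UNIV"
    using infinite_arbitrarily_large[OF inf] by (rule exE)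
  then have E: "finite E" "card E = card I * N + 1" by simp_all
  obtain y' where y': "y' \<noteq> 0" "\<And>Q a b. maximal_ideal Q \<Longrightarrow> y' \<notin> Q \<Longrightarrow> a \<in> E \<Longrightarrow> b \<in> E \<Longrightarrow> a \<noteq> b \<Longrightarrow>
    a - b \<notin> Q"
    using separating_element[OF E(1)] by metis
  define z where "z = (c * y')\<^sup>2"
  have z0: "z \<noteq> 0" using c(3) y'(1) by (simp add: z_def)
  define \<Q> where "\<Q> = {Q. maximal_ideal Q \<and> c * y' \<in> Q}"
  have fQ: "finite \<Q>" unfolding \<Q>_def using c(3) y'(1) by (intro finite_maximal_containing) simp
  have zQ: "loc Q z \<subseteq> Q" if "Q \<in> \<Q>" for Q
    using that by (intro loc_subset) (auto simp: \<Q>_def z_def power2_eq_square maximal_mult_iff)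
  have zc2: "loc Q z \<subseteq> loc Q (c\<^sup>2)"
    for Q by (rule loc_antimono) (simp add: z_def power_mult_distrib)
  have zc: "loc Q z \<subseteq> loc Q c" for Q by (rule loc_antimono) (simp add: z_def power2_eq_square)
  define prs where "prs v = {p \<in> Pr. fst p = v \<or> snd p = v}" for v
  define k where "k v = (\<Prod>p\<in>prs v. [:- \<rho> p, 1:])" for v
  have kl: "lead_coeff (k v) = 1" for v unfolding k_def by (simp add: lead_coeff_prod)
  have kN: "degree (k v) \<le> N" for v
  proof -
    have "finite (prs v)" "prs v \<subseteq> Pr" using Pr by (auto simp: prs_def)
    then have "degree (k v) \<le> card (prs v)" "card (prs v) \<le> card Pr"
      unfolding k_def using degree_prod_sum_le[of "prs v" "\<lambda>p. [:- \<rho> p, 1:]"] Pr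
        by (auto intro: card_mono)
    then show ?thesis unfolding N_def by linarith
  qed
  have kev: "poly (k v) x = (\<Prod>p\<in>prs v. x - \<rho> p)" for v x unfolding k_def by (simp add: poly_prod)
  define h where "h i Q = (if i =
    s then (if c \<in> Q then hs Q * monom 1 (N - degree (hs Q)) else monom 1 N)
    else if Q = P then k i * monom 1 (N - degree (k i)) else monom 1 N)" for i Q
  have Qmax: "maximal_ideal Q" if "Q \<in> \<Q>" for Q using that by (simp add: \<Q>_def)
  have h: "degree (h i Q) = N \<and> lead_coeff (h i Q) = 1" if "i \<in> I" "Q \<in> \<Q>" for i Q
  proof -
    have "degree (monom 1 N :: 'a poly) = N" "lead_coeff (monom 1 N :: 'a poly) = 1"
      by (simp_all add: degree_monom_eq)
    then show ?thesis
      unfolding h_def using monic_pad[OF hs(1)[OF Qmax[OF that(2)]] hsN[OF Qmax[OF that(2)]]] monic_pad[OF kl kN, of i]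
      by presburger
  qed
  have "N \<ge> 1" by (simp add: N_def)
  have "\<exists>F. inj_on F I \<and> (\<forall>i\<in>I. degree (F i) = N \<and> lead_coeff (F i) = 1 \<and>
    irreducible (map_poly to_fract (F i)) \<and> (\<forall>Q\<in>\<Q>. \<forall>k. coeff (F i - h i Q) k \<in> loc Q z))"
    by (rule irreducible_family[OF inf_max I \<open>N \<ge> 1\<close> fQ _ z0]) (erule Qmax, rule h)
  then obtain F where F: "inj_on F I" "\<And>i. i \<in> I \<Longrightarrow> degree (F i) = N"
    "\<And>i. i \<in> I \<Longrightarrow> lead_coeff (F i) = 1"
    "\<And>i. i \<in> I \<Longrightarrow> irreducible (map_poly to_fract (F i))"
    "\<And>i Q k. i \<in> I \<Longrightarrow> Q \<in> \<Q> \<Longrightarrow> coeff (F i - h i Q) k \<in> loc Q z"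
    by blast
  have cong: "poly (F i) x - poly (h i Q) x \<in> loc Q z" if "i \<in> I" "Q \<in> \<Q>" for i Q x
    using F(5)[OF that] that(2) by (intro poly_cong_ideal is_ideal_loc) (auto simp: \<Q>_def)
  have congQ: "poly (F i) x \<in> Q \<longleftrightarrow> poly (h i Q) x \<in> Q" if "i \<in> I" "Q \<in> \<Q>" for i Q x
    using cong[OF that] zQ[OF that(2)] that(2)
    by (intro ideal_mem_cong maximal_ideal_ideal) (auto simp: \<Q>_def)
  have cQ: "Q \<in> \<Q>" if "maximal_ideal Q" "c \<in> Q" for Q
    using that by (auto simp: \<Q>_def maximal_mult_iff)
  have PQ: "P \<in> \<Q>" using cQ[OF P(1) c(1)] .
  have sI: "s \<in> I" and UI: "\<And>t. t \<in> U \<Longrightarrow> t \<in> I \<and> t \<noteq> s" using U(2) by (auto simp: I_def)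
  have hs_eval: "poly (h s Q) x = poly (hs Q) x * x ^ (N - degree (hs Q))" if "c \<in> Q" for Q x
    using that by (simp add: h_def poly_monom)
  have ht_eval: "poly (h v P) x = (\<Prod>p\<in>prs v. x - \<rho> p) * x ^ (N - degree (k v))" if "v \<in> U" for v x
    using UI[OF that] by (simp add: h_def poly_monom kev)
  have ht_other: "poly (h v Q) x = x ^ N" if "v \<in> U" "Q \<noteq> P" for v x Q
    using UI[OF that(1)] that(2) by (simp add: h_def poly_monom)
  have fixdiv: "\<exists>x. (\<forall>t\<in>U. poly (F t) x \<notin> Q) \<and> (\<forall>q\<in>Q. poly (F s) x * (\<Prod>t\<in>U. poly (F t) x) \<noteq> c * q)"
    if Q: "maximal_ideal Q" for Q
  proof -
    have QI: "is_ideal Q" using Q by (rule maximal_ideal_ideal)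
    consider "c \<in> Q" | "c \<notin> Q" "y' \<in> Q" | "c \<notin> Q" "y' \<notin> Q" by blast
    then show ?thesis
    proof cases
      case 1
      have QQ: "Q \<in> \<Q>" using cQ[OF Q 1] .
      obtain x where x: "x - 1 \<in> Q" "locassoc Q c (poly (hs Q) x)" using hs(4)[OF Q] by blast
      have xQ: "x \<notin> Q" using ideal_mem_cong[OF QI x(1)] maximal_one_notin[OF Q] by blast
      have tQ: "poly (F t) x \<notin> Q" if t: "t \<in> U" for t
      proof (cases "Q = P")
        case True
        have "poly (h t P) x \<notin> P"
          unfolding ht_eval[OF t] maximal_mult_iff[OF P(1)]
        proof (intro notI, elim disjE)
          assume "(\<Prod>p\<in>prs t. x - \<rho> p) \<in> P"
          then obtain p where p: "p \<in> Pr" "x - \<rho> p \<in> P"            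
            using maximal_prod[OF P(1), of "prs t" "\<lambda>p. x - \<rho> p"] unfolding prs_def by blast
          have "1 - \<rho> p \<in> P"
            using ideal_diff_trans[OF PI ideal_diff_commute[OF PI] p(2), of 1] x(1) True by simp
          then show False using \<rho>P(2)[OF p(1)] by blast
        next
          assume "x ^ (N - degree (k t)) \<in> P"
          then show False using maximal_power[OF Q xQ] True by simp
        qed
        then show ?thesis using congQ[of t Q x] UI[OF t] QQ True by blast
      next
        case False
        then show ?thesis
          using congQ[of t Q x] UI[OF t] QQ ht_other[OF t False] maximal_power[OF Q xQ, of N]
            by simp
      qed
      define u where "u = (\<Prod>t\<in>U. poly (F t) x)"
      have uQ: "u \<notin> Q" unfolding u_def using tQ by (intro maximal_prod[OF Q]) auto
      define d where "d = x ^ (N - degree (hs Q)) * poly (hs Q) x"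
      have "locassoc Q c (u * d)" unfolding d_def
        by (intro locassoc_mult_unit[OF Q] x(2) uQ maximal_power[OF Q xQ])
      moreover have "poly (F s) x * u - u * d \<in> loc Q (c\<^sup>2)"
      proof -
        have "poly (F s) x - d \<in> loc Q (c\<^sup>2)"
          using cong[OF sI QQ, of x] zc2 unfolding hs_eval[OF 1] d_def by (auto simp: mult.commute)
        then have "u * (poly (F s) x - d) \<in> loc Q (c\<^sup>2)" by (rule ideal_mult[OF is_ideal_loc[OF Q]])
        then show ?thesis by (simp add: algebra_simps)
      qed
      ultimately have "poly (F s) x * u \<noteq> c * q" if "q \<in> Q" for q
        using locassoc_exact[OF Q 1 c(3) _ _ that] by blast
      then show ?thesis using tQ unfolding u_def by blast
    next
      case 2
      have QQ: "Q \<in> \<Q>" using Q 2(2) by (auto simp: \<Q>_def maximal_mult_iff)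
      have "Q \<noteq> P" using 2(1) c(1) by blast
      have iQ: "poly (F i) 1 \<notin> Q" if "i \<in> I" for i
        using congQ[OF that QQ, of 1] maximal_one_notin[OF Q] 2(1) \<open>Q \<noteq> P\<close>
          by (simp add: h_def poly_monom)
      then have "poly (F s) 1 * (\<Prod>t\<in>U. poly (F t) 1) \<notin> Q"
        unfolding maximal_mult_iff[OF Q] using maximal_prod[OF Q, of U "\<lambda>t. poly (F t) 1"] sI UI
          by blast
      moreover have "c * q \<in> Q" if "q \<in> Q" for q using that by (rule ideal_mult[OF QI])
      ultimately show ?thesis using iQ UI by (intro exI[of _ 1]) metis
    next
      case 3
      define g where "g = (\<Prod>i\<in>I. F i)"
      have Fnz: "F i \<noteq> 0" if "i \<in> I" for i using F(3)[OF that] by auto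
      have "degree g = (\<Sum>i\<in>I. degree (F i))"
        unfolding g_def using Fnz by (intro degree_prod_eq_sum_degree) auto
      also have "\<dots> = card I * N" using F(2) by simp
      finally have dg: "degree g < card E" using E(2) by simp
      have lg: "lead_coeff g \<notin> Q"
        unfolding g_def using F(3) maximal_one_notin[OF Q] by (simp add: lead_coeff_prod)
      obtain x where x: "poly g x \<notin> Q"
        using exists_nonroot_mod[OF maximal_imp_prime[OF Q] E(1) y'(2)[OF Q 3(2)] lg dg] by blast
      have g: "poly g x = poly (F s) x * (\<Prod>t\<in>U. poly (F t) x)"
        unfolding g_def I_def poly_prod using U by simp
      then have "poly (F t) x \<notin> Q" if "t \<in> U" for t
        using x ideal_mult[OF QI ideal_prod[OF QI U(1) that, of "\<lambda>t. poly (F t) x"]] by auto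
      moreover have "c * q \<in> Q" if "q \<in> Q" for q using that by (rule ideal_mult[OF QI])
      ultimately show ?thesis using x unfolding g by (intro exI[of _ x]) metis
    qed
  qed
  have UPr: "(t, u) \<in> Pr" if "t \<in> U" "u \<in> U" "fst t \<noteq> fst u"
    for t u using that by (simp add: Pr_def)
  have div: "(\<forall>x. c dvd poly (F s) x * (\<Prod>t\<in>U - W. poly (F t) x)) \<longleftrightarrow> (\<exists>k\<in>{1..n}. W \<subseteq> S k)"
    if W: "W \<subseteq> U" for W
  proof
    assume "\<exists>k\<in>{1..n}. W \<subseteq> S k"
    then obtain l where l: "W \<subseteq> S l" by blast
    show "\<forall>x. c dvd poly (F s) x * (\<Prod>t\<in>U - W. poly (F t) x)"
    proof (intro allI dvd_local[OF noeth])
      fix x and Q :: "'a set" assume Q: "maximal_ideal Q"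
      define u where "u = (\<Prod>t\<in>U - W. poly (F t) x)"
      consider "c \<notin> Q" | "c \<in> Q" "\<forall>b\<in>B Q. x - b \<notin> Q" | b where "c \<in> Q" "b \<in> B Q" "x - b \<in> Q"
        by blast
      then show "poly (F s) x * u \<in> loc Q c"
      proof cases
        case 1
        then show ?thesis by (rule locI) simp
      next
        case 2
        have LI: "is_ideal (loc Q c)" using Q by (rule is_ideal_loc)
        have "poly (h s Q) x \<in> loc Q c"
          unfolding hs_eval[OF 2(1)] using hs(2)[OF Q 2(2)] by (rule ideal_mult_right[OF LI])
        moreover have "poly (F s) x - poly (h s Q) x \<in> loc Q c"
          using cong[OF sI cQ[OF Q 2(1)]] zc by blast
        ultimately have "poly (F s) x \<in> loc Q c" using ideal_mem_cong[OF LI] by blast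
        then show ?thesis by (rule ideal_mult_right[OF LI])
      next
        case 3
        then have QP: "Q = P" by (auto simp: B_def split: if_splits)
        then obtain t v where tv: "(t, v) \<in> Pr" "x - \<rho> (t, v) \<in> P" using 3 by (auto simp: B_def)
        then have tvU: "t \<in> U" "v \<in> U" "fst t \<noteq> fst v" by (auto simp: Pr_def)
        have "fst i = l" if "i \<in> W" for i using l that by (auto simp: S_def)
        then obtain w where w: "w \<in> U - W" "w = t \<or> w = v" using tvU by (metis DiffI)
        have "(t, v) \<in> prs w" using tv(1) w(2) by (auto simp: prs_def)
        moreover have "finite (prs w)" using Pr by (simp add: prs_def)
        ultimately have "(\<Prod>p\<in>prs w. x - \<rho> p) \<in> P"
          using tv(2) by (intro ideal_prod[OF PI, of _ "(t, v)"])
        then have "poly (h w P) x \<in> P" using w(1) by (simp add: ht_eval maximal_mult_iff[OF P(1)])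
        then have "poly (F w) x \<in> P" using congQ[OF _ PQ] UI w(1) by blast
        then have "u \<in> P" unfolding u_def using w(1) U(1) by (intro ideal_prod[OF PI]) auto
        then have "poly (F s) x * u \<in> P" by (rule ideal_mult[OF PI])
        then show ?thesis using PlocP QP by blast
      qed
    qed
  next
    assume dv: "\<forall>x. c dvd poly (F s) x * (\<Prod>t\<in>U - W. poly (F t) x)"
    show "\<exists>k\<in>{1..n}. W \<subseteq> S k"
    proof (rule ccontr)
      assume contr: "\<not> (\<exists>k\<in>{1..n}. W \<subseteq> S k)"
      then have "W \<noteq> {}" using n by force
      then obtain t where t: "t \<in> W" by blast
      then have "fst t \<in> {1..n}" using W by (auto simp: U_def)
      then obtain v where v: "v \<in> W" "v \<notin> S (fst t)" using contr by blast
      have "fst t \<noteq> fst v" using v W by (auto simp: S_def U_def)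
      then have p: "(t, v) \<in> Pr" using UPr t v(1) W by blast
      define x where "x = \<rho> (t, v)"
      have xP: "x \<notin> P" using \<rho>P(1)[OF p] by (simp add: x_def)
      have "x \<in> B P" "x - x \<in> P" using p ideal_zero[OF PI] by (auto simp: B_def x_def)
      then have "poly (h s P) x \<notin> P"
        unfolding hs_eval[OF c(1)] maximal_mult_iff[OF P(1)]
          using hs(3)[OF P(1)] maximal_power[OF P(1) xP] by blast
      then have "poly (F s) x \<notin> P" using congQ[OF sI PQ] by blast
      moreover have "poly (F w) x \<notin> P" if w: "w \<in> U - W" for w
      proof -
        have "x - \<rho> p' \<notin> P" if p': "p' \<in> prs w" for p'
        proof -
          have "p' \<in> Pr" "(t, v) \<noteq> p'" using p' w t v(1) by (auto simp: prs_def)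
          then show ?thesis using \<rho>PP[OF p] by (simp add: x_def)
        qed
        then have "(\<Prod>p\<in>prs w. x - \<rho> p) \<notin> P" by (intro maximal_prod[OF P(1)])
        then have "poly (h w P) x \<notin> P"
          using w maximal_power[OF P(1) xP] by (simp add: ht_eval maximal_mult_iff[OF P(1)])
        then show ?thesis using congQ[OF _ PQ] UI w by blast
      qed
      then have "(\<Prod>t\<in>U - W. poly (F t) x) \<notin> P" by (intro maximal_prod[OF P(1)])
      ultimately have "poly (F s) x * (\<Prod>t\<in>U - W. poly (F t) x) \<notin> P"
        by (simp add: maximal_mult_iff[OF P(1)])
      then show False using ideal_dvd[OF PI c(1)] dv by blast
    qed
  qed
  have "factor_blocks T U s F c S n N"
  proof unfold_locales
    show "finite U" "s \<notin> U" "c \<noteq> 0" "1 \<le> N" by fact+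
    show "S k \<subseteq> U" if "k \<in> {1..n}" for k using that by (auto simp: S_def U_def)
    show "S k \<inter> S l = {}" if "k \<noteq> l" for k l using that by (auto simp: S_def)
    show "S k \<noteq> {}" if "k \<in> {1..n}" for k using m[OF that] by (auto simp: S_def lessThan_empty_iff)
    show "inj_on F (insert s U)" using F(1) by (simp add: I_def)
    show "degree (F i) = N" "lead_coeff (F i) = 1" "irreducible (map_poly to_fract (F i))"
      if "i \<in> insert s U" for i
      using F(2-4)[of i] that by (simp_all add: I_def)
    show "\<exists>x. \<forall>t\<in>U. poly (F t) x \<notin> Q" if "maximal_ideal Q" for Q using fixdiv[OF that] by blast
    show "\<exists>x. \<forall>q\<in>Q. poly (F s) x * (\<Prod>t\<in>U. poly (F t) x) \<noteq> c * q" if "maximal_ideal Q" for Q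
      using fixdiv[OF that] by blast
    show "(\<forall>x. c dvd poly (F s) x * (\<Prod>t\<in>U - W. poly (F t) x)) \<longleftrightarrow> (\<exists>k\<in>{1..n}. W \<subseteq> S k)" if "W \<subseteq> U"
      for W
      by (rule div[OF that])
  qed
  then show ?thesis unfolding U_def s_def S_def by blast
qed

end

theorem theorem4p1:
  fixes n :: nat and m :: "nat \<Rightarrow> nat"
  assumes ded: "dedekind_domain TYPE('a::idom)"
    and inf_max: "infinite {P::'a set. maximal_ideal P}"
    and fin_idx: "\<forall>P::'a set. maximal_ideal P \<longrightarrow> finite (residue_classes P)"
    and n1: "n \<ge> 1"
    and m1: "\<forall>i\<in>{1..n}. 1 \<le> m i"
    and mmono: "\<forall>i j. 1 \<le> i \<and> i \<le> j \<and> j \<le> n \<longrightarrow> m i \<le> m j"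
  shows "\<exists>H \<in> (IntD :: 'a fract poly set). \<exists>F :: nat \<Rightarrow> 'a fract poly list.
           (\<forall>i\<in>{1..n}. factorization_in IntD H (F i) \<and> length (F i) = m i + 1) \<and>
           (\<forall>i\<in>{1..n}. \<forall>j\<in>{1..n}. i \<noteq> j \<longrightarrow> \<not> ess_same_in IntD (F i) (F j)) \<and>
           (\<forall>fs. factorization_in IntD H fs \<longrightarrow> (\<exists>i\<in>{1..n}. ess_same_in IntD fs (F i)))"
proof -
  have "\<not> maximal_ideal {0 :: 'a}"
  proof
    assume zero: "maximal_ideal {0 :: 'a}"
    have "{P::'a set. maximal_ideal P} \<subseteq> {{0}}"
    proof
      fix Q :: "'a set" assume "Q \<in> {P. maximal_ideal P}"
      then have Q: "maximal_ideal Q" by simp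
      then have "{0} \<subseteq> Q" using ideal_zero[OF maximal_ideal_ideal] by blast
      then show "Q \<in> {{0}}" using maximal_subset_eq[OF zero Q] by simp
    qed
    then show False using inf_max finite_subset by blast
  qed
  then interpret dedekind "TYPE('a)" using ded by unfold_locales
  obtain F and c :: 'a and N where
    "factor_blocks TYPE('a) (SIGMA k:{1..n}. {..<m k}) (0, 0) F c (\<lambda>k. {k} \<times> {..<m k}) n N"
    using factor_blocks_exist[OF inf_max _ n1, of m] fin_idx m1 by blast
  then interpret factor_blocks "TYPE('a)" "SIGMA k:{1..n}. {..<m k}"
    "(0, 0)" F c "\<lambda>k. {k} \<times> {..<m k}" n N .
  show ?thesis
    using H_IntD[OF n1] fact_list_factorization fact_list_length fact_list_not_ess_same fact_list_complete
    by (intro bexI[of _ H] exI[of _ fact_list]) (auto simp: card_cartesian_product)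
qed

end
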